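(* Let $\alpha\in Q^\kappa_n$ and let $\phi$ be a map from the set of $\sigma$-orbits in $\bigcup_{\lambda\in\mathcal{P}^\kappa_{[\alpha]}}\mathcal{T}(\lambda)$ to $\bigcup_{\lambda\in\mathcal{P}^\kappa_{[\alpha]}}\mathcal{T}(\lambda)$ such that $\phi([\mathfrak{t}])\in[\mathfrak{t}]$ for every $\mathfrak{t}$. If $\#[\alpha]<p$ and $p$ is odd then the basis \[ \left\{\mu(c^{\lambda}_{\mathfrak{s}\mathfrak{t}}) : \lambda\in\mathcal{P}^\kappa_{[\alpha]},\ \mathfrak{s}\in\mathcal{T}(\lambda),\ \mathfrak{t}\in\mathcal{T}^\phi_0(\lambda)\right\} \] of $\mathcal{H}^\kappa_{p,[\alpha]}$ is not adapted cellular.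
   Context: Combinatorics. Let $d,\eta,p,n\geq 1$ be integers, $e:=\eta p\ge 2$, $r:=dp$; identify $\mathbb{Z}/e\mathbb{Z}$ with $\{0,\dots,e-1\}$ and $\mathbb{Z}/r\mathbb{Z}$ with $\{0,\dots,r-1\}$. Let $\kappa=(\kappa_0,\dots,\kappa_{r-1})\in(\mathbb{Z}/e\mathbb{Z})^r$ satisfy $\kappa_{k+d}=\kappa_k+\eta$ for all $k\in\mathbb{Z}/r\mathbb{Z}$. An $r$-partition of $n$ is an $r$-tuple $\lambda=(\lambda^{(0)},\dots,\lambda^{(r-1)})$ of partitions of total size $n$; $\mathcal{P}_n^\kappa$ is the set of these. Its Young diagram is $\mathcal{Y}(\lambda)=\{(a,b,c)\in \mathbb{N}^2\times\{0,\dots,r-1\} : a\text{ indexes a row of }\lambda^{(c)},\ 0\le b\le\lambda^{(c)}_a-1\}$ (rows indexed from $0$), and $\mathrm{res}_\kappa(a,b,c)=b-a+\kappa_c\in\mathbb{Z}/e\mathbb{Z}$. Let $Q^+=\bigoplus_{i\in\mathbb{Z}/e\mathbb{Z}}\mathbb{N}\alpha_i$, $\alpha_\kappa(\lambda)=\sum_{\gamma\in\mathcal{Y}(\lambda)}\alpha_{\mathrm{res}_\kappa(\gamma)}$, $Q^\kappa_n=\{\alpha_\kappa(\lambda):\lambda\in\mathcal{P}^\kappa_n\}$ and $\mathcal{P}_\alpha^\kappa=\{\lambda:\alpha_\kappa(\lambda)=\alpha\}$. The shift on $Q^+$ is the additive map with $\sigma\cdot\alpha_i=\alpha_{i+\eta}$;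 on $r$-partitions ${}^\sigma\lambda=(\lambda^{(r-d)},\dots,\lambda^{(r-1)},\lambda^{(0)},\dots,\lambda^{(r-d-1)})$. Orbits are denoted $[\alpha]$, $[\lambda]$; $\mathcal{P}^\kappa_{[\alpha]}=\bigcup_{\beta\in[\alpha]}\mathcal{P}^\kappa_\beta$ (which is $\sigma$-stable), and $\mathfrak{P}^\kappa_{[\alpha]}$ is the set of $\sigma$-orbits in $\mathcal{P}^\kappa_{[\alpha]}$. A standard $\lambda$-tableau is a bijection $\mathfrak{t}=(\mathfrak{t}^{(0)},\dots,\mathfrak{t}^{(r-1)}):\mathcal{Y}(\lambda)\to\{1,\dots,n\}$ increasing along rows and down columns in each component; $\mathcal{T}(\lambda)$ is the set of these, and $\mathrm{res}_\kappa(\mathfrak{t})=(\mathrm{res}_\kappa(\mathfrak{t}^{-1}(a)))_{1\le a\le n}$. The shift ${}^\sigma\mathfrak{t}=(\mathfrak{t}^{(r-d)},\dots,\mathfrak{t}^{(r-1)},\mathfrak{t}^{(0)},\dots,\mathfrak{t}^{(r-d-1)})$ is a standard ${}^\sigma\lambda$-tableau; $[\mathfrak{t}]$ is the $\sigma$-orbit of $\mathfrak{t}$. For $\phi$ as in the claim, $\mathcal{T}^\phi_0(\lambda)=\{\mathfrak{t}\in\mathcal{T}(\lambda):\phi([\mathfrak{t}])=\mathfrak{t}\}$. Put $\#\mathcal{T}_0[\lambda]:=\sum_{\nu\in[\lambda]}\#\mathcal{T}_0^\phi(\nu)=\frac1p\sum_{\nu\in[\lambda]}\#\mathcal{T}(\nu)$,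 which does not depend on $\phi$. Cellular algebras (Graham--Lehrer). Let $A$ be a finite-dimensional unital associative $F$-algebra. A cellular datum for $A$ is a triple $(\Lambda,\mathcal{T},c)$ where: $\Lambda$ is a finite partially ordered set; for each $\lambda\in\Lambda$ there is an indexing set $\mathcal{T}(\lambda)$ and distinct elements $c^\lambda_{\mathfrak{s}\mathfrak{t}}\in A$ ($\mathfrak{s},\mathfrak{t}\in\mathcal{T}(\lambda)$) such that $\{c^\lambda_{\mathfrak{s}\mathfrak{t}}\}$ (over all $\lambda,\mathfrak{s},\mathfrak{t}$) is an $F$-basis of $A$; for all $\lambda$, $\mathfrak{t}\in\mathcal{T}(\lambda)$, $a\in A$ there are scalars $r_{\mathfrak{t}\mathfrak{v}}(a)\in F$ with, for all $\mathfrak{s}\in\mathcal{T}(\lambda)$, $c^\lambda_{\mathfrak{s}\mathfrak{t}}a\equiv\sum_{\mathfrak{v}\in\mathcal{T}(\lambda)}r_{\mathfrak{t}\mathfrak{v}}(a)c^\lambda_{\mathfrak{s}\mathfrak{v}}$ modulo the span of the $c^\nu_{\mathfrak{a}\mathfrak{b}}$ with $\nu>\lambda$; and the linear map sending $c^\lambda_{\mathfrak{s}\mathfrak{t}}$ to $c^\lambda_{\mathfrak{t}\mathfrak{s}}$ is an algebra anti-automorphism of $A$. Algebra. Let $F$ be a field and $q\in F\setminus\{0,1\}$ of multiplicative order $e$. The Ariki--Koike algebra $\mathcal{H}_n^\kappa$ is the unital associative $F$-algebra with generators $S,T_1,\dots,T_{n-1}$ and relations $\prod_{k=0}^{r-1}(S-q^{\kappa_k})=0$,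 $ST_1ST_1=T_1ST_1S$, $ST_a=T_aS$ for $a\ge 2$, $(T_a+1)(T_a-q)=0$, $T_aT_b=T_bT_a$ for $|a-b|>1$, $T_aT_{a+1}T_a=T_{a+1}T_aT_{a+1}$. Let $\zeta\in F^\times$ have order $p$ and let $\sigma$ be the algebra automorphism of $\mathcal{H}_n^\kappa$ of order $p$ with $\sigma(S)=\zeta S$, $\sigma(T_a)=T_a$. Put $\mu=\sum_{j=0}^{p-1}\sigma^j:\mathcal{H}_n^\kappa\to\mathcal{H}_n^\kappa$. By known results (Brundan--Kleshchev, Rostam) $\mathcal{H}_n^\kappa$ is generated by elements (the Khovanov--Lauda generators) $e(\mathbf{i})$ for $\mathbf{i}\in(\mathbb{Z}/e\mathbb{Z})^n$, $\psi_1,\dots,\psi_{n-1}$, $y_1,\dots,y_n$, such that the $e(\mathbf{i})$ form a complete system of orthogonal idempotents and $\sigma(e(\mathbf{i}))=e(\mathbf{i}-(\eta,\dots,\eta))$, $\sigma(\psi_a)=\psi_a$, $\sigma(y_a)=y_a$. Let $*$ be the algebra anti-automorphism of $\mathcal{H}^\kappa_n$ fixing each of these generators. By known results (Hu--Mathas) there is a cellular datum $(\mathcal{P}^\kappa_n,\mathcal{T},c)$ for $\mathcal{H}_n^\kappa$ (for some partial order on $\mathcal{P}^\kappa_n$) with associated anti-automorphism $*$ and with $c^\lambda_{\mathfrak{s}\mathfrak{t}}\in e(\mathrm{res}_\kappa(\mathfrak{s}))\mathcal{H}_n^\kappa e(\mathrm{res}_\kappa(\mathfrak{t}))$ for all $\lambda\in\mathcal{P}_n^\kappa$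 and $\mathfrak{s},\mathfrak{t}\in\mathcal{T}(\lambda)$. These data are fixed. For $\beta=\sum_i\beta_i\alpha_i\in Q^+$ with $\sum_i\beta_i=n$, let $I^\beta\subseteq(\mathbb{Z}/e\mathbb{Z})^n$ be the set of tuples having exactly $\beta_i$ components equal to $i$ for every $i$, and $\mathcal{H}^\kappa_\beta=\sum_{\mathbf{i},\mathbf{j}\in I^\beta}e(\mathbf{i})\mathcal{H}^\kappa_ne(\mathbf{j})$. For $\alpha\in Q^\kappa_n$ put $\mathcal{H}^\kappa_{[\alpha]}=\bigoplus_{\beta\in[\alpha]}\mathcal{H}^\kappa_\beta$, which is $\sigma$-stable, and let $\mathcal{H}^\kappa_{p,[\alpha]}$ be its subalgebra of elements fixed by $\sigma$. The family displayed in the claim is an $F$-basis of $\mathcal{H}^\kappa_{p,[\alpha]}$ (another result of the paper). Adapted cellularity. A cellular datum $(\Lambda,\mathcal{T},c)$ for $\mathcal{H}^\kappa_{p,[\alpha]}$ is adapted if for every $[\lambda]\in\mathfrak{P}^\kappa_{[\alpha]}$ there exist $\lambda_{[\lambda],1},\dots,\lambda_{[\lambda],p/\#[\lambda]}\in\Lambda$ such that (i) $\#\mathcal{T}(\lambda_{[\lambda],j})=\#\mathcal{T}_0[\lambda]$ for all $j\in\{1,\dots,p/\#[\lambda]\}$; (ii) $\{\lambda_{[\lambda],j}:[\lambda]\in\mathfrak{P}^\kappa_{[\alpha]},\ 1\le j\le p/\#[\lambda]\}=\Lambda$; and moreover (iii) $(c^\lambda_{\mathfrak{s}\mathfrak{t}})^*=c^\lambda_{\mathfrak{t}\mathfrak{s}}$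 for all $\lambda\in\Lambda$ and $\mathfrak{s},\mathfrak{t}\in\mathcal{T}(\lambda)$, where $*$ is the anti-automorphism of $\mathcal{H}_n^\kappa$ fixed above. A basis of $\mathcal{H}^\kappa_{p,[\alpha]}$ is adapted cellular if it coincides with $\{c^\lambda_{\mathfrak{s}\mathfrak{t}}:\lambda\in\Lambda,\ \mathfrak{s},\mathfrak{t}\in\mathcal{T}(\lambda)\}$ for some adapted cellular datum $(\Lambda,\mathcal{T},c)$ for $\mathcal{H}^\kappa_{p,[\alpha]}$. *)

theory Defs
  imports Complex_Main "HOL-Library.Multiset" "HOL-Library.Poly_Mapping"
begin

section \<open>Multipartitions, residues and tableaux\<close>

text \<open>The class of \<open>i\<close> in \<open>\<int>/e\<int>\<close> is represented by the integer in \<open>{0..<e}\<close>, and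
  \<open>r\<close>-tuples indexed by \<open>{0..<r}\<close> are lists of length \<open>r\<close>.\<close>

type_synonym multipartition = "nat list list"
type_synonym node = "nat \<times> nat \<times> nat"

definition is_partition :: "nat list \<Rightarrow> bool" where
  "is_partition l \<longleftrightarrow> sorted_wrt (\<ge>) l \<and> 0 \<notin> set l"

definition multipartitions :: "nat \<Rightarrow> nat \<Rightarrow> multipartition set" where
  "multipartitions r n =
     {l. length l = r \<and> (\<forall>x\<in>set l. is_partition x) \<and> sum_list (map sum_list l) = n}"

definition young :: "multipartition \<Rightarrow> node set" where
  "young l = {(a, b, c). c < length l \<and> a < length (l ! c) \<and> b < l ! c ! a}"

definition res :: "nat \<Rightarrow> (nat \<Rightarrow> int) \<Rightarrow> node \<Rightarrow> int" where
  "res e \<kappa> = (\<lambda>(a, b, c). (int b - int a + \<kappa> c) mod int e)"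

text \<open>The free commutative monoid \<open>Q\<^sup>+\<close> on the \<open>\<alpha>\<^sub>i\<close> is modelled by multisets, \<open>\<alpha>\<^sub>i\<close> being \<open>{#i#}\<close>.\<close>

definition content :: "nat \<Rightarrow> (nat \<Rightarrow> int) \<Rightarrow> multipartition \<Rightarrow> int multiset" where
  "content e \<kappa> l = (\<Sum>\<gamma>\<in>young l. {#res e \<kappa> \<gamma>#})"

definition content_shift :: "nat \<Rightarrow> nat \<Rightarrow> int multiset \<Rightarrow> int multiset" where
  "content_shift e \<eta> = image_mset (\<lambda>i. (i + int \<eta>) mod int e)"

text \<open>The shift of an \<open>r\<close>-tuple; it is used both for \<open>r\<close>-partitions and for tableaux.\<close>

definition shift :: "nat \<Rightarrow> nat \<Rightarrow> 'a list \<Rightarrow> 'a list" where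
  "shift r d x = drop (r - d) x @ take (r - d) x"

text \<open>In all uses \<open>f\<close> acts with finite order, so nonnegative powers give the whole orbit.\<close>

definition orb :: "('a \<Rightarrow> 'a) \<Rightarrow> 'a \<Rightarrow> 'a set" where
  "orb f x = range (\<lambda>j. (f ^^ j) x)"

definition multipartitions_orb ::
  "nat \<Rightarrow> nat \<Rightarrow> (nat \<Rightarrow> int) \<Rightarrow> nat \<Rightarrow> nat \<Rightarrow> int multiset \<Rightarrow> multipartition set" where
  "multipartitions_orb e \<eta> \<kappa> r n \<alpha> =
     (\<Union>\<beta>\<in>orb (content_shift e \<eta>) \<alpha>. {l \<in> multipartitions r n. content e \<kappa> l = \<beta>})"

definition orbit_shapes ::
  "nat \<Rightarrow> nat \<Rightarrow> (nat \<Rightarrow> int) \<Rightarrow> nat \<Rightarrow> nat \<Rightarrow> nat \<Rightarrow> int multiset \<Rightarrow> multipartition set set" where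
  "orbit_shapes e \<eta> \<kappa> d r n \<alpha> = orb (shift r d) ` multipartitions_orb e \<eta> \<kappa> r n \<alpha>"

text \<open>A tableau is the list of its components, each being the list of its rows. It determines
  its shape, so that the sets of tableaux of distinct shapes are disjoint.\<close>

type_synonym tableau = "nat list list list"

definition entry :: "tableau \<Rightarrow> node \<Rightarrow> nat" where
  "entry t = (\<lambda>(a, b, c). t ! c ! a ! b)"

definition std_tableaux :: "multipartition \<Rightarrow> tableau set" where
  "std_tableaux l =
     {t. map (map length) t = l \<and>
         bij_betw (entry t) (young l) {1..card (young l)} \<and>
         (\<forall>a b c. (a, Suc b, c) \<in> young l \<longrightarrow> entry t (a, b, c) < entry t (a, Suc b, c)) \<and>
         (\<forall>a b c. (Suc a, b, c) \<in> young l \<longrightarrow> entry t (a, b, c) < entry t (Suc a, b, c))}"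

definition res_seq :: "nat \<Rightarrow> (nat \<Rightarrow> int) \<Rightarrow> multipartition \<Rightarrow> tableau \<Rightarrow> int list" where
  "res_seq e \<kappa> l t =
     map (\<lambda>m. res e \<kappa> (inv_into (young l) (entry t) m)) [1..<Suc (card (young l))]"

definition std_tableaux0 ::
  "nat \<Rightarrow> nat \<Rightarrow> (tableau set \<Rightarrow> tableau) \<Rightarrow> multipartition \<Rightarrow> tableau set" where
  "std_tableaux0 r d \<phi> l = {t \<in> std_tableaux l. \<phi> (orb (shift r d) t) = t}"

definition card_std_tableaux0 ::
  "nat \<Rightarrow> nat \<Rightarrow> (tableau set \<Rightarrow> tableau) \<Rightarrow> multipartition set \<Rightarrow> nat" where
  "card_std_tableaux0 r d \<phi> \<omega> = (\<Sum>\<nu>\<in>\<omega>. card (std_tableaux0 r d \<phi> \<nu>))"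


section \<open>Algebras and cellular data\<close>

locale assoc_algebra = vector_space scale
  for scale :: "'f::field \<Rightarrow> 'h::ring_1 \<Rightarrow> 'h" +
  assumes scale_mult_left: "scale a x * y = scale a (x * y)"
    and scale_mult_right: "x * scale a y = scale a (x * y)"

definition mult_order :: "'f::field \<Rightarrow> nat \<Rightarrow> bool" where
  "mult_order x m \<longleftrightarrow> m > 0 \<and> x ^ m = 1 \<and> (\<forall>k. 0 < k \<and> k < m \<longrightarrow> x ^ k \<noteq> 1)"

definition fun_order :: "('a \<Rightarrow> 'a) \<Rightarrow> nat \<Rightarrow> bool" where
  "fun_order f m \<longleftrightarrow> m > 0 \<and> f ^^ m = id \<and> (\<forall>k. 0 < k \<and> k < m \<longrightarrow> f ^^ k \<noteq> id)"

definition linear_bij_on :: "('f \<Rightarrow> 'h \<Rightarrow> 'h) \<Rightarrow> 'h set \<Rightarrow> ('h \<Rightarrow> 'h::ring_1) \<Rightarrow> bool" where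
  "linear_bij_on scale A f \<longleftrightarrow> bij_betw f A A \<and>
     (\<forall>x\<in>A. \<forall>y\<in>A. f (x + y) = f x + f y) \<and> (\<forall>a. \<forall>x\<in>A. f (scale a x) = scale a (f x))"

text \<open>\<open>A\<close> may be a subalgebra whose unit is not the unit of the ambient algebra; a multiplicative
  or antimultiplicative bijection of \<open>A\<close> preserves the unit of \<open>A\<close> automatically.\<close>

definition automorphism_on :: "('f \<Rightarrow> 'h \<Rightarrow> 'h) \<Rightarrow> 'h set \<Rightarrow> ('h \<Rightarrow> 'h::ring_1) \<Rightarrow> bool" where
  "automorphism_on scale A f \<longleftrightarrow>
     linear_bij_on scale A f \<and> (\<forall>x\<in>A. \<forall>y\<in>A. f (x * y) = f x * f y)"

definition anti_automorphism_on :: "('f \<Rightarrow> 'h \<Rightarrow> 'h) \<Rightarrow> 'h set \<Rightarrow> ('h \<Rightarrow> 'h::ring_1) \<Rightarrow> bool" where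
  "anti_automorphism_on scale A f \<longleftrightarrow>
     linear_bij_on scale A f \<and> (\<forall>x\<in>A. \<forall>y\<in>A. f (x * y) = f y * f x)"

definition generates :: "('f::field \<Rightarrow> 'h \<Rightarrow> 'h::ring_1) \<Rightarrow> 'h set \<Rightarrow> bool" where
  "generates scale X \<longleftrightarrow> module.span scale (prod_list ` lists X) = UNIV"

definition cellular_basis :: "'l set \<Rightarrow> ('l \<Rightarrow> 'i set) \<Rightarrow> ('l \<Rightarrow> 'i \<Rightarrow> 'i \<Rightarrow> 'h) \<Rightarrow> 'h set" where
  "cellular_basis \<Lambda> \<T> c = {c l s t | l s t. l \<in> \<Lambda> \<and> s \<in> \<T> l \<and> t \<in> \<T> l}"

text \<open>Cellular data for a finite-dimensional subalgebra \<open>A\<close>; \<open>(l, m) \<in> le\<close> stands for \<open>l \<le> m\<close>.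
  Finiteness of \<open>\<T> l\<close> is a consequence of \<open>dim A < \<infinity>\<close>.\<close>

definition cellular_datum ::
  "('f::field \<Rightarrow> 'h \<Rightarrow> 'h::ring_1) \<Rightarrow> 'h set \<Rightarrow> 'l set \<Rightarrow> 'l rel \<Rightarrow> ('l \<Rightarrow> 'i set) \<Rightarrow>
   ('l \<Rightarrow> 'i \<Rightarrow> 'i \<Rightarrow> 'h) \<Rightarrow> bool" where
  "cellular_datum scale A \<Lambda> le \<T> c \<longleftrightarrow>
     finite \<Lambda> \<and> partial_order_on \<Lambda> le \<and> (\<forall>l\<in>\<Lambda>. finite (\<T> l)) \<and>
     inj_on (\<lambda>(l, s, t). c l s t) {(l, s, t). l \<in> \<Lambda> \<and> s \<in> \<T> l \<and> t \<in> \<T> l} \<and>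
     \<not> module.dependent scale (cellular_basis \<Lambda> \<T> c) \<and>
     module.span scale (cellular_basis \<Lambda> \<T> c) = A \<and>
     (\<forall>l\<in>\<Lambda>. \<forall>t\<in>\<T> l. \<forall>a\<in>A. \<exists>\<rho> :: 'i \<Rightarrow> 'f. \<forall>s\<in>\<T> l.
        c l s t * a - (\<Sum>v\<in>\<T> l. scale (\<rho> v) (c l s v))
          \<in> module.span scale (cellular_basis {m \<in> \<Lambda>. (l, m) \<in> le \<and> l \<noteq> m} \<T> c)) \<and>
     (\<exists>\<iota>. anti_automorphism_on scale A \<iota> \<and>
        (\<forall>l\<in>\<Lambda>. \<forall>s\<in>\<T> l. \<forall>t\<in>\<T> l. \<iota> (c l s t) = c l t s))"


section \<open>Algebras given by generators and relations\<close>

datatype 'g fword = FWord (letters: "'g list")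

instantiation fword :: (type) monoid_add
begin
definition zero_fword :: "'a fword" where "0 = FWord []"
definition plus_fword :: "'a fword \<Rightarrow> 'a fword \<Rightarrow> 'a fword" where
  "u + v = FWord (letters u @ letters v)"
instance
  by standard (auto simp: zero_fword_def plus_fword_def)
end

text \<open>The additive monoid \<open>'g fword\<close> is the free monoid under concatenation, hence
  \<open>'g fword \<Rightarrow>\<^sub>0 'f\<close>, with the convolution product, is the free associative \<open>'f\<close>-algebra on \<open>'g\<close>.\<close>

definition free_scalar :: "'f::field \<Rightarrow> 'g fword \<Rightarrow>\<^sub>0 'f" where
  "free_scalar a = Poly_Mapping.single 0 a"

definition free_gen :: "'g \<Rightarrow> 'g fword \<Rightarrow>\<^sub>0 'f::field" where
  "free_gen g = Poly_Mapping.single (FWord [g]) 1"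

definition free_algebra :: "'g set \<Rightarrow> ('g fword \<Rightarrow>\<^sub>0 'f::field) set" where
  "free_algebra X = {f. \<forall>w\<in>Poly_Mapping.keys f. set (letters w) \<subseteq> X}"

definition free_eval ::
  "('f::field \<Rightarrow> 'h \<Rightarrow> 'h::ring_1) \<Rightarrow> ('g \<Rightarrow> 'h) \<Rightarrow> ('g fword \<Rightarrow>\<^sub>0 'f) \<Rightarrow> 'h" where
  "free_eval scale g f = (\<Sum>w\<in>Poly_Mapping.keys f. scale (Poly_Mapping.lookup f w) (prod_list (map g (letters w))))"

inductive_set two_sided_ideal :: "'a::ring_1 set \<Rightarrow> 'a set \<Rightarrow> 'a set"
  for A :: "'a set" and R :: "'a set" where
  zero: "0 \<in> two_sided_ideal A R"
| gen: "u \<in> A \<Longrightarrow> x \<in> R \<Longrightarrow> v \<in> A \<Longrightarrow> u * x * v \<in> two_sided_ideal A R"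
| add: "x \<in> two_sided_ideal A R \<Longrightarrow> y \<in> two_sided_ideal A R \<Longrightarrow> x + y \<in> two_sided_ideal A R"

text \<open>The algebra is presented by the generators \<open>g x\<close> (\<open>x \<in> X\<close>) and the relations \<open>f = 0\<close>
  (\<open>f \<in> R\<close>): evaluation identifies it with the quotient of the free algebra on \<open>X\<close> by the
  two-sided ideal generated by \<open>R\<close>.\<close>

definition presented_by ::
  "('f::field \<Rightarrow> 'h \<Rightarrow> 'h::ring_1) \<Rightarrow> 'g set \<Rightarrow> ('g fword \<Rightarrow>\<^sub>0 'f) set \<Rightarrow> ('g \<Rightarrow> 'h) \<Rightarrow> bool" where
  "presented_by scale X R g \<longleftrightarrow>
     free_eval scale g ` free_algebra X = UNIV \<and>
     {f \<in> free_algebra X. free_eval scale g f = 0} = two_sided_ideal (free_algebra X) R"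


section \<open>The Ariki--Koike algebra\<close>

datatype ak_gen = GenS | GenT nat

definition ak_gens :: "nat \<Rightarrow> ak_gen set" where
  "ak_gens n = insert GenS (GenT ` {1..<n})"

definition ak_relators ::
  "'f::field \<Rightarrow> (nat \<Rightarrow> int) \<Rightarrow> nat \<Rightarrow> nat \<Rightarrow> (ak_gen fword \<Rightarrow>\<^sub>0 'f) set" where
  "ak_relators q \<kappa> r n =
    (let S = free_gen GenS; T = (\<lambda>a. free_gen (GenT a)) in
      {prod_list (map (\<lambda>k. S - free_scalar (q powi \<kappa> k)) [0..<r])}
      \<union> (if 1 < n then {S * T 1 * S * T 1 - T 1 * S * T 1 * S} else {})
      \<union> {S * T a - T a * S | a. 2 \<le> a \<and> a < n}
      \<union> {(T a + 1) * (T a - free_scalar q) | a. 1 \<le> a \<and> a < n}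
      \<union> {T a * T b - T b * T a | a b. 1 \<le> a \<and> a < n \<and> 1 \<le> b \<and> b < n \<and> \<bar>int a - int b\<bar> > 1}
      \<union> {T a * T (a + 1) * T a - T (a + 1) * T a * T (a + 1) | a. 1 \<le> a \<and> a + 1 < n})"

definition ariki_koike ::
  "('f::field \<Rightarrow> 'h \<Rightarrow> 'h::ring_1) \<Rightarrow> 'f \<Rightarrow> (nat \<Rightarrow> int) \<Rightarrow> nat \<Rightarrow> nat \<Rightarrow> 'h \<Rightarrow> (nat \<Rightarrow> 'h) \<Rightarrow> bool"
  where
  "ariki_koike scale q \<kappa> r n S T \<longleftrightarrow>
     assoc_algebra scale \<and>
     presented_by scale (ak_gens n) (ak_relators q \<kappa> r n) (case_ak_gen S T)"

definition mu :: "nat \<Rightarrow> ('h \<Rightarrow> 'h) \<Rightarrow> 'h \<Rightarrow> 'h::ring_1" where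
  "mu p \<sigma> x = (\<Sum>j<p. (\<sigma> ^^ j) x)"

definition residue_tuples :: "nat \<Rightarrow> nat \<Rightarrow> int list set" where
  "residue_tuples e n = {i. length i = n \<and> set i \<subseteq> {0..<int e}}"

definition KL_generators ::
  "('f::field \<Rightarrow> 'h \<Rightarrow> 'h::ring_1) \<Rightarrow> nat \<Rightarrow> nat \<Rightarrow> nat \<Rightarrow> ('h \<Rightarrow> 'h) \<Rightarrow>
   (int list \<Rightarrow> 'h) \<Rightarrow> (nat \<Rightarrow> 'h) \<Rightarrow> (nat \<Rightarrow> 'h) \<Rightarrow> bool" where
  "KL_generators scale e \<eta> n \<sigma> \<epsilon> \<psi> y \<longleftrightarrow>
     generates scale (\<epsilon> ` residue_tuples e n \<union> \<psi> ` {1..<n} \<union> y ` {1..n}) \<and>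
     (\<forall>i\<in>residue_tuples e n. \<forall>j\<in>residue_tuples e n. \<epsilon> i * \<epsilon> j = (if i = j then \<epsilon> i else 0)) \<and>
     (\<Sum>i\<in>residue_tuples e n. \<epsilon> i) = 1 \<and>
     (\<forall>i\<in>residue_tuples e n. \<sigma> (\<epsilon> i) = \<epsilon> (map (\<lambda>k. (k - int \<eta>) mod int e) i)) \<and>
     (\<forall>a\<in>{1..<n}. \<sigma> (\<psi> a) = \<psi> a) \<and>
     (\<forall>a\<in>{1..n}. \<sigma> (y a) = y a)"

definition block ::
  "('f::field \<Rightarrow> 'h \<Rightarrow> 'h::ring_1) \<Rightarrow> nat \<Rightarrow> nat \<Rightarrow> (int list \<Rightarrow> 'h) \<Rightarrow> int multiset \<Rightarrow> 'h set" where
  "block scale e n \<epsilon> \<beta> =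
     module.span scale {\<epsilon> i * h * \<epsilon> j | i h j.
       i \<in> residue_tuples e n \<and> mset i = \<beta> \<and> j \<in> residue_tuples e n \<and> mset j = \<beta>}"

definition block_orb ::
  "('f::field \<Rightarrow> 'h \<Rightarrow> 'h::ring_1) \<Rightarrow> nat \<Rightarrow> nat \<Rightarrow> nat \<Rightarrow> (int list \<Rightarrow> 'h) \<Rightarrow> int multiset \<Rightarrow> 'h set"
  where
  "block_orb scale e \<eta> n \<epsilon> \<alpha> =
     module.span scale (\<Union>\<beta>\<in>orb (content_shift e \<eta>) \<alpha>. block scale e n \<epsilon> \<beta>)"

definition fixed_block_orb ::
  "('f::field \<Rightarrow> 'h \<Rightarrow> 'h::ring_1) \<Rightarrow> nat \<Rightarrow> nat \<Rightarrow> nat \<Rightarrow> (int list \<Rightarrow> 'h) \<Rightarrow> ('h \<Rightarrow> 'h) \<Rightarrow>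
   int multiset \<Rightarrow> 'h set" where
  "fixed_block_orb scale e \<eta> n \<epsilon> \<sigma> \<alpha> = {x \<in> block_orb scale e \<eta> n \<epsilon> \<alpha>. \<sigma> x = x}"

text \<open>Adaptedness of a cellular datum for the subalgebra \<open>A\<close>, where \<open>Orbs\<close> is the set of orbits of
  shapes and \<open>N \<omega>\<close> is the prescribed number of tableaux for the orbit \<open>\<omega>\<close>. The size of an
  orbit divides \<open>p\<close>, so the division is exact. The elements \<open>L \<omega> j\<close> need not be distinct.\<close>

definition adapted_cellular_datum ::
  "('f::field \<Rightarrow> 'h \<Rightarrow> 'h::ring_1) \<Rightarrow> 'h set \<Rightarrow> ('h \<Rightarrow> 'h) \<Rightarrow> nat \<Rightarrow>
   multipartition set set \<Rightarrow> (multipartition set \<Rightarrow> nat) \<Rightarrow>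
   'l set \<Rightarrow> 'l rel \<Rightarrow> ('l \<Rightarrow> 'i set) \<Rightarrow> ('l \<Rightarrow> 'i \<Rightarrow> 'i \<Rightarrow> 'h) \<Rightarrow> bool" where
  "adapted_cellular_datum scale A star p Orbs N \<Lambda> le \<T> c \<longleftrightarrow>
     cellular_datum scale A \<Lambda> le \<T> c \<and>
     (\<exists>L. (\<forall>\<omega>\<in>Orbs. \<forall>j\<in>{1..p div card \<omega>}. L \<omega> j \<in> \<Lambda> \<and> card (\<T> (L \<omega> j)) = N \<omega>) \<and>
          {L \<omega> j | \<omega> j. \<omega> \<in> Orbs \<and> j \<in> {1..p div card \<omega>}} = \<Lambda>) \<and>
     (\<forall>l\<in>\<Lambda>. \<forall>s\<in>\<T> l. \<forall>t\<in>\<T> l. star (c l s t) = c l t s)"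

end

theory Submission
  imports Defs
begin

text \<open>
The anti-automorphism \<open>*\<close> decides the question. In a cellular basis on which \<open>*\<close> exchanges the
two indices, exactly the elements \<open>c\<^sub>s\<^sub>s\<close> are fixed by \<open>*\<close>, so an adapted cellular basis has \<open>\<Sum>\<^sub>\<lambda>
#\<T>(\<lambda>)\<close> fixed elements. On the other hand, suppose that \<open>\<mu>(c\<^sub>s\<^sub>t)\<close> is fixed. Between the
idempotents of the residue sequences of \<open>t\<close> and \<open>s\<close> it has the component \<open>c\<^sub>t\<^sub>s \<noteq> 0\<close>, and a
summand \<open>\<sigma>\<^sup>j(c\<^sub>s\<^sub>t)\<close> can contribute to it only if \<open>2j\<eta> = 0\<close> modulo \<open>e\<close>. Since \<open>p\<close> is odd, \<open>j =
0\<close>, hence \<open>c\<^sub>t\<^sub>s = c\<^sub>s\<^sub>t\<close> and \<open>s = t\<close> (\<open>star_fixed_mu\<close>). So the family in question has at most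
\<open>\<Sum>\<^sub>\<omega> N\<^sub>\<omega>\<close> fixed elements, where \<open>\<omega>\<close> runs over the orbits of shapes and \<open>N\<^sub>\<omega>\<close> is the number of
chosen tableaux of shape in \<open>\<omega>\<close>.

An adapted datum attaches \<open>p/#\<omega>\<close> cells of size \<open>N\<^sub>\<omega>\<close> to each orbit \<open>\<omega>\<close>. The definition allows
coincidences among these cells, but the dimension of the fixed subalgebra is at least \<open>\<Sum>\<^sub>\<omega> (p/#\<omega>)
N\<^sub>\<omega>\<^sup>2\<close>: multiplication by the sum of the idempotents whose first residue is less than \<open>\<eta>\<close>
recovers \<open>c\<^sub>s\<^sub>t\<close> from \<open>\<mu>(c\<^sub>s\<^sub>t)\<close> whenever the residue sequence of \<open>t\<close> starts below \<open>\<eta>\<close>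
(\<open>mu_low_idem\<close>), and these tableaux are as numerous in each orbit as the chosen ones because both
families meet every free \<open>\<sigma>\<close>-orbit of tableaux once. Therefore no cells coincide
(\<open>square_sum_forces_injective\<close>) and the number of fixed elements is \<open>\<Sum>\<^sub>\<omega> (p/#\<omega>) N\<^sub>\<omega>\<close>. This
exceeds \<open>\<Sum>\<^sub>\<omega> N\<^sub>\<omega>\<close> as soon as one orbit of shapes has fewer than \<open>p\<close> elements, because every shape
has a standard tableau.

The existence of such an orbit when \<open>#[\<alpha>] < p\<close> is the combinatorial core
(\<open>stuttering_shape_exists\<close>). Some \<open>\<sigma>\<^sup>g\<close> with \<open>g\<close> a proper divisor of \<open>p\<close> fixes \<open>\<alpha>\<close>. Reading
residues modulo \<open>h = g\<eta>\<close> instead of \<open>e\<close>, a shape of content \<open>\<alpha>\<close> becomes a multipartition whose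
charges each occur \<open>s = p/g\<close> times and whose content is \<open>s\<close> times some \<open>a\<close>. It suffices to find a
\<open>gd\<close>-multipartition of content \<open>a\<close> modulo \<open>h\<close>, since \<open>s\<close> copies of it side by side have content
\<open>\<alpha>\<close> modulo \<open>e\<close> and are fixed by \<open>\<sigma>\<^sup>g\<close>. Its existence is a saturation property
(\<open>content_saturation\<close>). In the language of the affine Lie algebra of type \<open>A\<close> the contents are
the weights of the irreducible module of highest weight \<open>\<Lambda>\<close>, that is, the elements of \<open>\<Lambda> - Q\<^sup>+\<close>
in the convex hull of the Weyl orbit of \<open>\<Lambda>\<close>, and this description is compatible with
multiplication by \<open>s\<close>. The proof below performs the Weyl reflections on Young diagrams.
\<close>


section \<open>Nodes that can be added to or removed from a diagram\<close>

text \<open>A Young diagram of an \<open>R\<close>-tuple of partitions, taken as a set of nodes so that many nodes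
  can be added or removed at the same time.\<close>

definition is_diagram :: "nat \<Rightarrow> node set \<Rightarrow> bool" where
  "is_diagram R Y \<longleftrightarrow> finite Y \<and> (\<forall>a b c. (a, b, c) \<in> Y \<longrightarrow> c < R) \<and>
     (\<forall>a b c. (Suc a, b, c) \<in> Y \<longrightarrow> (a, b, c) \<in> Y) \<and>
     (\<forall>a b c. (a, Suc b, c) \<in> Y \<longrightarrow> (a, b, c) \<in> Y)"

definition addable :: "nat \<Rightarrow> node set \<Rightarrow> node set" where
  "addable R Y = {(a, b, c). (a, b, c) \<notin> Y \<and> c < R \<and>
     (a = 0 \<or> (a - 1, b, c) \<in> Y) \<and> (b = 0 \<or> (a, b - 1, c) \<in> Y)}"

definition removable :: "node set \<Rightarrow> node set" where
  "removable Y = {(a, b, c). (a, b, c) \<in> Y \<and> (Suc a, b, c) \<notin> Y \<and> (a, Suc b, c) \<notin> Y}"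

text \<open>The residue is not reduced here, because the same diagram will be read modulo \<open>e\<close> and
  modulo a divisor of \<open>e\<close>.\<close>

definition int_res :: "(nat \<Rightarrow> int) \<Rightarrow> node \<Rightarrow> int" where
  "int_res \<kappa> = (\<lambda>(a, b, c). int b - int a + \<kappa> c)"

definition dvd_ind :: "nat \<Rightarrow> int \<Rightarrow> int" where
  "dvd_ind m x = of_bool (int m dvd x)"

definition res_count :: "nat \<Rightarrow> (nat \<Rightarrow> int) \<Rightarrow> node set \<Rightarrow> int \<Rightarrow> int" where
  "res_count m \<kappa> Y i = (\<Sum>y\<in>Y. dvd_ind m (int_res \<kappa> y - i))"

definition charge_count :: "nat \<Rightarrow> (nat \<Rightarrow> int) \<Rightarrow> nat \<Rightarrow> int \<Rightarrow> int" where
  "charge_count m \<kappa> R i = (\<Sum>c<R. dvd_ind m (\<kappa> c - i))"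

text \<open>For affine \<open>sl\<^sub>m\<close> this is the pairing of the \<open>i\<close>-th simple coroot with the weight \<open>\<Lambda> - \<Sum>\<^sub>j
  a\<^sub>j \<alpha>\<^sub>j\<close>, where \<open>\<Lambda>\<close> is the sum of the fundamental weights indexed by the charges. For
  \<open>m\<close>-periodic \<open>a\<close> the formula is also right in the degenerate cases \<open>m = 2\<close>, where both
  neighbours of \<open>i\<close> coincide, and \<open>m = 1\<close>, where the terms in \<open>a\<close> cancel.\<close>

definition hub :: "nat \<Rightarrow> (nat \<Rightarrow> int) \<Rightarrow> nat \<Rightarrow> (int \<Rightarrow> int) \<Rightarrow> int \<Rightarrow> int" where
  "hub m \<kappa> R a i = charge_count m \<kappa> R i - 2 * a i + a (i - 1) + a (i + 1)"

lemma dvd_ind_nonneg: "0 \<le> dvd_ind m x"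
  by (simp add: dvd_ind_def)

lemma dvd_ind_cong: "int m dvd x - y \<Longrightarrow> dvd_ind m x = dvd_ind m y" for x y :: int
  using dvd_add_right_iff[of "int m" "x - y" y] by (simp add: dvd_ind_def)

lemma addable_subset:
  "addable R Y \<subseteq> (\<lambda>c. (0, 0, c)) ` {..<R} \<union> (\<lambda>(a, b, c). (a, Suc b, c)) ` Y \<union> (\<lambda>(a, b, c). (Suc a, b, c)) ` Y"
proof
  fix x assume "x \<in> addable R Y"
  then obtain a b c where x: "x = (a, b, c)" "(a, b, c) \<notin> Y" "c < R"
      "a = 0 \<or> (a - 1, b, c) \<in> Y" "b = 0 \<or> (a, b - 1, c) \<in> Y"
    by (auto simp: addable_def)
  show "x \<in> (\<lambda>c. (0, 0, c)) ` {..<R} \<union> (\<lambda>(a, b, c). (a, Suc b, c)) ` Y \<union> (\<lambda>(a, b, c). (Suc a, b, c)) ` Y"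
  proof (cases a)
    case (Suc a')
    then have "x = (\<lambda>(a, b, c). (Suc a, b, c)) (a', b, c)" "(a', b, c) \<in> Y" using x by auto
    then show ?thesis by blast
  next
    case 0
    show ?thesis
    proof (cases b)
      case (Suc b')
      then have "x = (\<lambda>(a, b, c). (a, Suc b, c)) (a, b', c)" "(a, b', c) \<in> Y" using x by auto
      then show ?thesis by blast
    qed (use 0 x in auto)
  qed
qed

lemma is_diagram_finite: "is_diagram R Y \<Longrightarrow> finite Y"
  unfolding is_diagram_def by blast

lemma finite_addable: "is_diagram R Y \<Longrightarrow> finite (addable R Y)"
  by (rule finite_subset[OF addable_subset]) (simp add: is_diagram_finite)

lemma sum_of_bool_subset:
  fixes g :: "'a \<Rightarrow> int"
  assumes "finite B" "X \<subseteq> B"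
  shows "(\<Sum>x\<in>B. of_bool (x \<in> X) * g x) = sum g X"
  by (rule sum.mono_neutral_cong_right) (use assms in auto)

text \<open>Moving a node one step to the right raises its residue by one, moving it down lowers its
  residue by one, and a diagonal step preserves it. Hence the four terms of the hub count, with
  signs, the nodes of residue \<open>i\<close> in the set of corners, the diagram, and its three translates.
  Comparing a node with its neighbours above, to the left, and diagonally above shows that these
  counts cancel except at addable nodes and at the diagonal translates of removable nodes.\<close>

lemma addable_minus_removable:
  assumes Y: "is_diagram R Y"
  shows "int (card {x \<in> addable R Y. int m dvd int_res \<kappa> x - i}) -
         int (card {x \<in> removable Y. int m dvd int_res \<kappa> x - i})
       = hub m \<kappa> R (res_count m \<kappa> Y) i"
proof -
  define g where "g = (\<lambda>x. dvd_ind m (int_res \<kappa> x - i))"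
  define O0 where "O0 = (\<lambda>c. (0::nat, 0::nat, c)) ` {..<R}"
  define rt :: "node \<Rightarrow> node" where "rt = (\<lambda>(a, b, c). (a, Suc b, c))"
  define dn :: "node \<Rightarrow> node" where "dn = (\<lambda>(a, b, c). (Suc a, b, c))"
  define dg :: "node \<Rightarrow> node" where "dg = (\<lambda>(a, b, c). (Suc a, Suc b, c))"
  define B where "B = O0 \<union> rt ` Y \<union> dn ` Y \<union> Y \<union> dg ` Y"
  have finY: "finite Y" and cR: "\<And>a b c. (a, b, c) \<in> Y \<Longrightarrow> c < R"
    and cl1: "\<And>a b c. (Suc a, b, c) \<in> Y \<Longrightarrow> (a, b, c) \<in> Y"
    and cl2: "\<And>a b c. (a, Suc b, c) \<in> Y \<Longrightarrow> (a, b, c) \<in> Y"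
    using Y unfolding is_diagram_def by blast+
  have finB: "finite B" unfolding B_def O0_def using finY by auto
  have AB: "addable R Y \<subseteq> B"
    using addable_subset[of R Y] unfolding B_def O0_def rt_def dn_def by blast
  have RB: "dg ` removable Y \<subseteq> B" unfolding B_def removable_def by auto
  have inj: "inj rt" "inj dn" "inj dg" unfolding rt_def dn_def dg_def by (auto simp: inj_def)
  have mem_dg: "((a, b, c) \<in> dg ` X) = (\<exists>a' b'. a = Suc a' \<and> b = Suc b' \<and> (a', b', c) \<in> X)" for a b c X
    unfolding dg_def by force
  have mem_rt: "((a, b, c) \<in> rt ` X) = (\<exists>b'. b = Suc b' \<and> (a, b', c) \<in> X)" for a b c X
    unfolding rt_def by force
  have mem_dn: "((a, b, c) \<in> dn ` X) = (\<exists>a'. a = Suc a' \<and> (a', b, c) \<in> X)" for a b c X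
    unfolding dn_def by force
  have mem_O: "((a, b, c) \<in> O0) = (a = 0 \<and> b = 0 \<and> c < R)" for a b c
    unfolding O0_def by force
  \<comment> \<open>The memberships on the right are decided by the node and its neighbours above, to the left,
    and diagonally above; on the first row or column some of these neighbours do not exist.\<close>
  have pt: "(of_bool (x \<in> addable R Y) - of_bool (x \<in> dg ` removable Y) :: int) =
      of_bool (x \<in> O0) + of_bool (x \<in> rt ` Y) + of_bool (x \<in> dn ` Y) - of_bool (x \<in> Y) - of_bool (x \<in> dg ` Y)"
    for x
  proof -
    obtain a b c where x: "x = (a, b, c)" by (cases x)
    show ?thesis
      unfolding x mem_dg mem_rt mem_dn mem_O
      by (cases a; cases b) (auto simp: addable_def removable_def dest: cl1 cl2 cR)
  qed
  have sum_g: "int (card {x \<in> X. int m dvd int_res \<kappa> x - i}) = sum g X" if "finite X" for X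
    using that unfolding g_def dvd_ind_def of_bool_def by (simp add: sum.inter_filter[symmetric])
  have s1: "sum g (dg ` removable Y) = sum g (removable Y)"
    using inj by (subst sum.reindex) (auto intro!: sum.cong simp: g_def int_res_def dg_def inj_on_def)
  have "sum g (addable R Y) - sum g (removable Y) =
    (\<Sum>x\<in>B. (of_bool (x \<in> addable R Y) - of_bool (x \<in> dg ` removable Y)) * g x)"
    by (simp only: left_diff_distrib sum_subtractf sum_of_bool_subset[OF finB AB] sum_of_bool_subset[OF finB RB] s1)
  also have "\<dots> = sum g O0 + sum g (rt ` Y) + sum g (dn ` Y) - sum g Y - sum g (dg ` Y)"
    unfolding pt left_diff_distrib distrib_right sum_subtractf sum.distrib
    by (subst (1 2 3 4 5) sum_of_bool_subset[OF finB]) (auto simp: B_def)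
  also have "sum g O0 = charge_count m \<kappa> R i"
    unfolding O0_def charge_count_def
    by (subst sum.reindex) (auto simp: inj_on_def g_def int_res_def)
  also have "sum g (rt ` Y) = res_count m \<kappa> Y (i - 1)"
    unfolding res_count_def using inj
    by (subst sum.reindex) (auto intro!: sum.cong simp: g_def int_res_def rt_def inj_on_def algebra_simps)
  also have "sum g (dn ` Y) = res_count m \<kappa> Y (i + 1)"
    unfolding res_count_def using inj
    by (subst sum.reindex) (auto intro!: sum.cong simp: g_def int_res_def dn_def inj_on_def algebra_simps)
  also have "sum g (dg ` Y) = res_count m \<kappa> Y i"
    unfolding res_count_def using inj
    by (subst sum.reindex) (auto intro!: sum.cong simp: g_def int_res_def dg_def inj_on_def algebra_simps)
  also have "sum g Y = res_count m \<kappa> Y i"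
    by (simp add: res_count_def g_def)
  finally have "sum g (addable R Y) - sum g (removable Y) = hub m \<kappa> R (res_count m \<kappa> Y) i"
    unfolding hub_def by simp
  moreover have "finite (removable Y)" using finY by (rule finite_subset[rotated]) (auto simp: removable_def)
  ultimately show ?thesis using sum_g finite_addable[OF Y] by simp
qed

lemma is_diagram_add:
  assumes "is_diagram R Y" "X \<subseteq> addable R Y"
  shows "is_diagram R (Y \<union> X)"
proof -
  have "finite X" using assms finite_addable finite_subset by blast
  moreover have "c < R" "a = 0 \<or> (a - 1, b, c) \<in> Y" "b = 0 \<or> (a, b - 1, c) \<in> Y"
    if "(a, b, c) \<in> X" for a b c
    using assms(2) that by (auto simp: addable_def)
  ultimately show ?thesis
    using assms(1) unfolding is_diagram_def
    by (metis Un_iff diff_Suc_1 finite_UnI nat.distinct(1))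
qed

lemma is_diagram_remove:
  assumes "is_diagram R Y" "X \<subseteq> removable Y"
  shows "is_diagram R (Y - X)"
proof -
  have "(Suc a, b, c) \<notin> Y" "(a, Suc b, c) \<notin> Y" if "(a, b, c) \<in> X" for a b c
    using assms(2) that by (auto simp: removable_def)
  then show ?thesis
    using assms(1) unfolding is_diagram_def by (metis DiffD1 DiffI finite_Diff)
qed

lemma dvd_ind_shift:
  assumes "int m dvd u - i"
  shows "dvd_ind m (u - j) = dvd_ind m (i - j)"
  by (rule dvd_ind_cong) (use assms in simp)

lemma res_count_const:
  assumes "\<And>x. x \<in> X \<Longrightarrow> int m dvd int_res \<kappa> x - i"
  shows "res_count m \<kappa> X j = int (card X) * dvd_ind m (i - j)"
proof -
  have "res_count m \<kappa> X j = (\<Sum>x\<in>X. dvd_ind m (i - j))"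
    unfolding res_count_def by (rule sum.cong) (use assms dvd_ind_shift in auto)
  then show ?thesis by simp
qed

lemma res_count_periodic:
  assumes "int m dvd i - j"
  shows "res_count m \<kappa> Y i = res_count m \<kappa> Y j"
  unfolding res_count_def
  by (intro sum.cong refl dvd_ind_cong) (use assms in \<open>simp add: dvd_diff_commute\<close>)

lemma charge_count_nonneg: "0 \<le> charge_count m \<kappa> R i"
  unfolding charge_count_def by (simp add: sum_nonneg dvd_ind_nonneg)

lemma res_count_nonneg: "0 \<le> res_count m \<kappa> R i"
  unfolding res_count_def by (simp add: sum_nonneg dvd_ind_nonneg)

lemma sum_dvd_ind:
  assumes "m > 0"
  shows "(\<Sum>i<m. dvd_ind m (x - int i)) = 1"
proof -
  have "dvd_ind m (x - int i) = of_bool (i = nat (x mod int m))" if "i < m" for i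
  proof -
    have "int m dvd x - int i \<longleftrightarrow> x mod int m = int i mod int m"
      by (simp add: mod_eq_dvd_iff)
    also have "\<dots> \<longleftrightarrow> i = nat (x mod int m)" using that assms by (auto simp: nat_eq_iff)
    finally show ?thesis by (simp add: dvd_ind_def)
  qed
  then have "(\<Sum>i<m. dvd_ind m (x - int i)) = (\<Sum>i<m. of_bool (i = nat (x mod int m)))"
    by (intro sum.cong) auto
  also have "\<dots> = 1"
    using assms by (simp add: of_bool_def nat_less_iff)
  finally show ?thesis .
qed

lemma sum_res_count:
  assumes "m > 0"
  shows "(\<Sum>i<m. res_count m \<kappa> Y (int i)) = int (card Y)"
  unfolding res_count_def using assms by (subst sum.swap) (simp add: sum_dvd_ind)

lemma sum_periodic_shift:
  fixes f :: "int \<Rightarrow> int"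
  assumes "f (int m) = f 0"
  shows "(\<Sum>i<m. f (int i + 1)) = (\<Sum>i<m. f (int i))"
proof (cases m)
  case (Suc k)
  have "(\<Sum>i<m. f (int i + 1)) = (\<Sum>i<k. f (int (Suc i))) + f (int m)"
    using Suc by (simp add: algebra_simps)
  also have "\<dots> = (\<Sum>i<m. f (int i))"
    unfolding Suc using assms[unfolded Suc] by (subst sum.lessThan_Suc_shift) simp
  finally show ?thesis .
qed simp

text \<open>The quadratic form of the affine Cartan matrix of type \<open>A\<close> is a sum of squares that
  vanishes only on constant vectors.\<close>

lemma cyclic_cartan_form:
  fixes c :: "int \<Rightarrow> int"
  assumes "\<And>i j. int m dvd i - j \<Longrightarrow> c i = c j"
  shows "(\<Sum>i<m. c (int i) * (2 * c (int i) - c (int i - 1) - c (int i + 1)))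
       = (\<Sum>i<m. (c (int i) - c (int i + 1))\<^sup>2)"
proof -
  have per: "c (int m) = c 0" "c (int m - 1) = c (-1)" by (rule assms, simp)+
  then have 1: "(\<Sum>i<m. (c (int i + 1))\<^sup>2) = (\<Sum>i<m. (c (int i))\<^sup>2)"
    by (intro sum_periodic_shift[of "\<lambda>i. (c i)\<^sup>2"]) simp
  from per have 2: "(\<Sum>i<m. c (int i + 1) * c (int i)) = (\<Sum>i<m. c (int i) * c (int i - 1))"
    using sum_periodic_shift[of "\<lambda>i. c i * c (i - 1)" m] by simp
  have "(\<Sum>i<m. (c (int i) - c (int i + 1))\<^sup>2) =
    (\<Sum>i<m. (c (int i))\<^sup>2) + (\<Sum>i<m. (c (int i + 1))\<^sup>2) - 2 * (\<Sum>i<m. c (int i + 1) * c (int i))"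
    by (simp add: power2_diff sum.distrib sum_subtractf sum_distrib_left algebra_simps)
  also have "\<dots> = 2 * (\<Sum>i<m. (c (int i))\<^sup>2) - (\<Sum>i<m. c (int i) * c (int i - 1)) - (\<Sum>i<m. c (int i + 1) * c (int i))"
    using 1 2 by simp
  also have "\<dots> = (\<Sum>i<m. c (int i) * (2 * c (int i) - c (int i - 1) - c (int i + 1)))"
    by (simp add: sum.distrib sum_subtractf sum_distrib_left algebra_simps power2_eq_square)
  finally show ?thesis by simp
qed

text \<open>The first row of the first component can always be prolonged.\<close>

lemma addable_exists:
  assumes "is_diagram R Y" "R > 0"
  shows "addable R Y \<noteq> {}"
proof -
  have "finite ((\<lambda>b. (0::nat, b::nat, 0::nat)) -` Y)"
    using assms by (intro finite_vimageI) (auto simp: is_diagram_finite inj_def)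
  then obtain b where "(0, b, 0) \<notin> Y" by (metis UNIV_I ex_new_if_finite infinite_UNIV_nat vimageI)
  then obtain b where b: "(0, b, 0) \<notin> Y" "\<And>b'. b' < b \<Longrightarrow> (0, b', 0) \<in> Y"
    using exists_least_iff[of "\<lambda>b. (0, b, 0) \<notin> Y"] by auto
  then have "b = 0 \<or> (0, b - 1, 0) \<in> Y" by (cases b) auto
  then have "(0, b, 0) \<in> addable R Y"
    unfolding addable_def using b assms by auto
  then show ?thesis by blast
qed

text \<open>Among the diagrams whose content is bounded by \<open>a\<close>, take a largest one and let \<open>c\<close> be the
  missing content. By maximality no node of residue \<open>i\<close> is addable when \<open>c\<^sub>i > 0\<close>, so the hub of
  the diagram is nonpositive there. Pairing this hub with \<open>c\<close> gives a nonpositive number, but it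
  is also the sum of the pairing of \<open>c\<close> with the nonnegative hub of \<open>a\<close> and of the Cartan form of
  \<open>c\<close>. Thus \<open>c\<close> is constant, and it is zero because otherwise no node at all would be addable.\<close>

lemma dominant_content_exists:
  assumes m: "m > 0" and R: "R > 0"
    and per: "\<And>i j. int m dvd i - j \<Longrightarrow> a i = a j"
    and nonneg: "\<And>i. 0 \<le> a i" and dom: "\<And>i. 0 \<le> hub m \<kappa> R a i"
  shows "\<exists>Y. is_diagram R Y \<and> (\<forall>i. res_count m \<kappa> Y i = a i)"
proof -
  define P where "P Y \<longleftrightarrow> is_diagram R Y \<and> (\<forall>i. res_count m \<kappa> Y i \<le> a i)" for Y
  have P0: "P {}" using nonneg by (simp add: P_def is_diagram_def res_count_def)
  have bnd: "card Y < Suc (nat (\<Sum>i<m. a (int i)))" if "P Y" for Y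
  proof -
    have "int (card Y) = (\<Sum>i<m. res_count m \<kappa> Y (int i))" using sum_res_count[OF m] by simp
    also have "\<dots> \<le> (\<Sum>i<m. a (int i))" using that by (intro sum_mono) (auto simp: P_def)
    finally show ?thesis by linarith
  qed
  obtain Y where PY: "P Y" and max: "\<And>Z. P Z \<Longrightarrow> card Z \<le> card Y"
    using ex_has_greatest_nat[of P "{}" card, OF P0] bnd by (meson less_imp_le)
  have Y: "is_diagram R Y" using PY P_def by auto
  define c where "c i = a i - res_count m \<kappa> Y i" for i
  have c_nonneg: "0 \<le> c i" for i using PY by (simp add: c_def P_def)
  have c_per: "c i = c j" if "int m dvd i - j" for i j
    using per[OF that] res_count_periodic[OF that] by (simp add: c_def)
  have no_add: "\<not> int m dvd int_res \<kappa> x - i" if x: "x \<in> addable R Y" and ci: "c i > 0" for x i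
  proof
    assume dv: "int m dvd int_res \<kappa> x - i"
    have xY: "x \<notin> Y" using x by (auto simp: addable_def)
    have finY: "finite Y" by (rule is_diagram_finite[OF Y])
    have "res_count m \<kappa> (Y \<union> {x}) j \<le> a j" for j
    proof -
      have "res_count m \<kappa> (Y \<union> {x}) j = res_count m \<kappa> Y j + dvd_ind m (i - j)"
        using xY finY dvd_ind_shift[OF dv] by (simp add: res_count_def)
      moreover have "dvd_ind m (i - j) \<le> c j"
        using c_nonneg[of j] c_per[of i j] ci by (auto simp: dvd_ind_def)
      ultimately show ?thesis by (simp add: c_def)
    qed
    then have "P (Y \<union> {x})" using is_diagram_add[OF Y, of "{x}"] x by (simp add: P_def)
    from max[OF this] show False using xY finY by simp
  qed
  have hub_le: "hub m \<kappa> R (res_count m \<kappa> Y) i \<le> 0" if "c i > 0" for i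
  proof -
    have "{x \<in> addable R Y. int m dvd int_res \<kappa> x - i} = {}" using no_add that by blast
    then have "card {x \<in> addable R Y. int m dvd int_res \<kappa> x - i} = 0" by (simp only: card.empty)
    then show ?thesis using addable_minus_removable[OF Y, of m \<kappa> i] by linarith
  qed
  \<comment> \<open>The hub is affine in the content, with the affine Cartan matrix as linear part.\<close>
  have hub_eq: "hub m \<kappa> R (res_count m \<kappa> Y) i = hub m \<kappa> R a i + (2 * c i - c (i - 1) - c (i + 1))" for i
    by (simp add: hub_def c_def)
  have "0 \<ge> (\<Sum>i<m. c (int i) * hub m \<kappa> R (res_count m \<kappa> Y) (int i))"
    using hub_le c_nonneg by (intro sum_nonpos) (metis mult_nonneg_nonpos order_le_less mult_zero_left order_refl)
  also have "(\<Sum>i<m. c (int i) * hub m \<kappa> R (res_count m \<kappa> Y) (int i)) =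
    (\<Sum>i<m. c (int i) * hub m \<kappa> R a (int i)) + (\<Sum>i<m. (c (int i) - c (int i + 1))\<^sup>2)"
    using cyclic_cartan_form[of m c] c_per by (simp add: hub_eq distrib_left sum.distrib)
  finally have "(\<Sum>i<m. c (int i) * hub m \<kappa> R a (int i)) + (\<Sum>i<m. (c (int i) - c (int i + 1))\<^sup>2) \<le> 0" .
  moreover have "0 \<le> (\<Sum>i<m. c (int i) * hub m \<kappa> R a (int i))"
    using c_nonneg dom by (intro sum_nonneg) auto
  moreover have "0 \<le> (\<Sum>i<m. (c (int i) - c (int i + 1))\<^sup>2)" by (intro sum_nonneg) auto
  ultimately have "(\<Sum>i<m. (c (int i) - c (int i + 1))\<^sup>2) = 0" by linarith
  then have step: "c (int i) = c (int i + 1)" if "i < m" for i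
    using that by (simp add: sum_nonneg_eq_0_iff)
  have "c (int i) = c 0" if "i < m" for i
    using that by (induction i) (use step in \<open>auto simp: algebra_simps\<close>)
  then have const: "c i = c 0" for i
  proof -
    have "int (nat (i mod int m)) = i mod int m" "nat (i mod int m) < m"
      using m by (simp_all add: nat_less_iff)
    moreover have "c i = c (i mod int m)" by (rule c_per) (simp add: minus_mod_eq_mult_div)
    ultimately show ?thesis using \<open>\<And>i. i < m \<Longrightarrow> c (int i) = c 0\<close> by metis
  qed
  have "c 0 = 0"
  proof (rule ccontr)
    assume "c 0 \<noteq> 0"
    then have "c i > 0" for i using const[of i] c_nonneg[of i] by linarith
    then have "\<not> int m dvd int_res \<kappa> x - int_res \<kappa> x" if "x \<in> addable R Y" for x
      using no_add that by blast
    then show False using addable_exists[OF Y R] by auto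
  qed
  then have "res_count m \<kappa> Y i = a i" for i using const[of i] by (simp add: c_def)
  then show ?thesis using Y by blast
qed

text \<open>Induction on the size of the given diagram. If the hub of \<open>a\<close> is nonnegative everywhere,
  the previous lemma applies. If its value at \<open>i\<close> is \<open>-k < 0\<close>, the diagram of content \<open>s a\<close> has
  at least \<open>s k\<close> removable nodes of residue \<open>i\<close>; removing \<open>s k\<close> of them divides evenly by \<open>s\<close> and
  amounts to the simple reflection \<open>a \<mapsto> a - k \<alpha>\<^sub>i\<close>. The diagram that the induction provides for
  the reflected content has at least \<open>k\<close> addable nodes of residue \<open>i\<close>, and adding \<open>k\<close> of them
  undoes the reflection.\<close>

theorem content_saturation:
  assumes m: "m > 0" and R: "R > 0" and s: "s > 0"
    and w: "\<And>i. charge_count m \<kappa>' R' i = int s * charge_count m \<kappa> R i"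
    and Y': "is_diagram R' Y'" and cont: "\<And>i. res_count m \<kappa>' Y' i = int s * a i"
  shows "\<exists>Y. is_diagram R Y \<and> (\<forall>i. res_count m \<kappa> Y i = a i)"
  using Y' cont
proof (induction "card Y'" arbitrary: Y' a rule: less_induct)
  case less
  have per: "a i = a j" if "int m dvd i - j" for i j
    using res_count_periodic[OF that, of \<kappa>' Y'] less.prems(2) s by simp
  have nonneg: "0 \<le> a i" for i
    using res_count_nonneg[of m \<kappa>' Y' i] less.prems(2)[of i] s by (simp add: zero_le_mult_iff)
  have hub': "hub m \<kappa>' R' (res_count m \<kappa>' Y') i = int s * hub m \<kappa> R a i" for i
    by (simp add: hub_def w less.prems(2) algebra_simps)
  show ?case
  proof (cases "\<forall>i. 0 \<le> hub m \<kappa> R a i")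
    case True
    then show ?thesis by (intro dominant_content_exists[OF m R] per nonneg) auto
  next
    case False
    then obtain i where i: "hub m \<kappa> R a i < 0" by (auto simp: not_le)
    define k where "k = nat (- hub m \<kappa> R a i)"
    have k: "k > 0" "hub m \<kappa> R a i = - int k" using i by (auto simp: k_def)
    \<comment> \<open>For \<open>m = 1\<close> the hub is the number of components, which is not negative.\<close>
    have m1: "\<not> int m dvd 1"
    proof
      assume "int m dvd 1"
      then have "a (i - 1) = a i" "a (i + 1) = a i"
        by (intro per; simp)+
      then show False using i charge_count_nonneg[of m \<kappa> R i] by (simp add: hub_def)
    qed
    have ind1: "dvd_ind m (i - (i - 1)) = 0" "dvd_ind m (i - (i + 1)) = 0" "dvd_ind m (i - i) = 1"
      using m1 by (auto simp: dvd_ind_def)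
    have "int (s * k) \<le> int (card {x \<in> removable Y'. int m dvd int_res \<kappa>' x - i})"
      using addable_minus_removable[OF less.prems(1), of m \<kappa>' i] hub'[of i] k(2) by simp
    then obtain X where X: "X \<subseteq> {x \<in> removable Y'. int m dvd int_res \<kappa>' x - i}" "card X = s * k" "finite X"
      by (meson obtain_subset_with_card_n of_nat_le_iff)
    have XY: "X \<subseteq> Y'" using X by (auto simp: removable_def)
    have finY': "finite Y'" by (rule is_diagram_finite[OF less.prems(1)])
    have "X \<noteq> {}" using X(2) s k(1) by auto
    then have smaller: "card (Y' - X) < card Y'" using XY finY' by (intro psubset_card_mono) auto
    define a' where "a' j = a j - int k * dvd_ind m (i - j)" for j
    have "res_count m \<kappa>' (Y' - X) j = int s * a' j" for j
    proof -
      have "res_count m \<kappa>' (Y' - X) j = res_count m \<kappa>' Y' j - res_count m \<kappa>' X j"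
        unfolding res_count_def by (rule sum_diff[OF finY' XY])
      also have "res_count m \<kappa>' X j = int (s * k) * dvd_ind m (i - j)"
        using res_count_const[of X m \<kappa>' i] X by auto
      finally show ?thesis by (simp add: less.prems(2) a'_def algebra_simps)
    qed
    then obtain Y where Y: "is_diagram R Y" "\<And>j. res_count m \<kappa> Y j = a' j"
      using less.hyps[OF smaller is_diagram_remove[OF less.prems(1)], of a'] X(1) by blast
    have "res_count m \<kappa> Y = a'" using Y(2) by blast
    then have "hub m \<kappa> R (res_count m \<kappa> Y) i = int k"
      using k(2) ind1 by (simp add: hub_def a'_def)
    then have "int k \<le> int (card {x \<in> addable R Y. int m dvd int_res \<kappa> x - i})"
      using addable_minus_removable[OF Y(1), of m \<kappa> i] by simp
    then obtain Z where Z: "Z \<subseteq> {x \<in> addable R Y. int m dvd int_res \<kappa> x - i}" "card Z = k" "finite Z"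
      by (meson obtain_subset_with_card_n of_nat_le_iff)
    have disj: "Y \<inter> Z = {}" using Z by (auto simp: addable_def)
    have finY: "finite Y" by (rule is_diagram_finite[OF Y(1)])
    have "res_count m \<kappa> (Y \<union> Z) j = a j" for j
    proof -
      have "res_count m \<kappa> (Y \<union> Z) j = res_count m \<kappa> Y j + res_count m \<kappa> Z j"
        unfolding res_count_def by (rule sum.union_disjoint) (use finY Z disj in auto)
      also have "res_count m \<kappa> Z j = int k * dvd_ind m (i - j)"
        using res_count_const[of Z m \<kappa> i] Z by auto
      finally show ?thesis by (simp add: Y(2) a'_def)
    qed
    moreover have "is_diagram R (Y \<union> Z)" using is_diagram_add[OF Y(1)] Z(1) by blast
    ultimately show ?thesis by blast
  qed
qed

section \<open>Multipartitions and their diagrams\<close>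

lemma initial_segment_eq:
  fixes X :: "nat set"
  assumes "finite X" "\<And>k. Suc k \<in> X \<Longrightarrow> k \<in> X"
  shows "X = {..<card X}"
proof -
  obtain n where n: "n \<notin> X" using assms(1) ex_new_if_finite infinite_UNIV_nat by blast
  define k where "k = (LEAST n. n \<notin> X)"
  have k: "k \<notin> X" "\<And>j. j < k \<Longrightarrow> j \<in> X"
    unfolding k_def using n LeastI[of "\<lambda>n. n \<notin> X"] not_less_Least[of _ "\<lambda>n. n \<notin> X"] by blast+
  have "j \<notin> X" if "k \<le> j" for j
    using that k(1) assms(2) by (induction j rule: dec_induct) auto
  then have "X = {..<k}" using k by (auto simp: not_less[symmetric])
  then show ?thesis by simp
qed

lemma young_eq_Union:
  "young l = (\<Union>c<length l. \<Union>a<length (l ! c). (\<lambda>b. (a, b, c)) ` {..<l ! c ! a})"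
  by (auto simp: young_def)

lemma finite_young: "finite (young l)"
  unfolding young_eq_Union by blast

lemma card_young: "card (young l) = sum_list (map sum_list l)"
proof -
  have "card (young l) = (\<Sum>c<length l. card (\<Union>a<length (l ! c). (\<lambda>b. (a, b, c)) ` {..<l ! c ! a}))"
    unfolding young_eq_Union by (rule card_UN_disjoint) auto
  also have "\<dots> = (\<Sum>c<length l. \<Sum>a<length (l ! c). card ((\<lambda>b. (a, b, c)) ` {..<l ! c ! a}))"
    by (intro sum.cong refl card_UN_disjoint) auto
  also have "\<dots> = (\<Sum>c<length l. \<Sum>a<length (l ! c). l ! c ! a)"
    by (intro sum.cong refl) (subst card_image; simp add: inj_on_def)
  finally show ?thesis
    by (simp add: sum_list_sum_nth atLeast0LessThan)
qed

lemma is_diagram_young: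
  assumes "l \<in> multipartitions r n"
  shows "is_diagram r (young l)"
proof -
  have len: "length l = r" and part: "\<And>c. c < r \<Longrightarrow> is_partition (l ! c)"
    using assms by (auto simp: multipartitions_def)
  have "l ! c ! Suc a \<le> l ! c ! a" if "c < r" "Suc a < length (l ! c)" for a c
    using part[OF that(1)] that(2) unfolding is_partition_def
    by (metis lessI sorted_wrt_nth_less)
  then have "(a, b, c) \<in> young l" if "(Suc a, b, c) \<in> young l" for a b c
    using that len by (simp add: young_def) (meson less_le_trans)
  moreover have "(a, b, c) \<in> young l" if "(a, Suc b, c) \<in> young l" for a b c
    using that by (simp add: young_def)
  moreover have "c < r" if "(a, b, c) \<in> young l" for a b c
    using that len by (simp add: young_def)
  ultimately show ?thesis
    unfolding is_diagram_def using finite_young by blast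
qed

text \<open>Inverse of \<open>young\<close>: the rows of a component are counted in its first column.\<close>

definition diagram_shape :: "nat \<Rightarrow> node set \<Rightarrow> multipartition" where
  "diagram_shape r Y =
     map (\<lambda>c. map (\<lambda>a. card {b. (a, b, c) \<in> Y}) [0..<card {a. (a, 0, c) \<in> Y}]) [0..<r]"

lemma diagram_rows:
  assumes Y: "is_diagram r Y"
  shows "(a, b, c) \<in> Y \<longleftrightarrow> b < card {b. (a, b, c) \<in> Y}"
    and "(a, 0, c) \<in> Y \<longleftrightarrow> a < card {a. (a, 0, c) \<in> Y}"
proof -
  have cl: "\<And>a b c. (Suc a, b, c) \<in> Y \<Longrightarrow> (a, b, c) \<in> Y" "\<And>a b c. (a, Suc b, c) \<in> Y \<Longrightarrow> (a, b, c) \<in> Y"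
    using Y unfolding is_diagram_def by blast+
  have "finite ((\<lambda>b. (a, b, c)) -` Y)" "finite ((\<lambda>a. (a, 0, c)) -` Y)"
    using is_diagram_finite[OF Y] by (auto intro!: finite_vimageI simp: inj_def)
  then have fin: "finite {b. (a, b, c) \<in> Y}" "finite {a. (a, 0, c) \<in> Y}"
    by (simp_all add: vimage_def)
  have eq: "{b. (a, b, c) \<in> Y} = {..<card {b. (a, b, c) \<in> Y}}"
      "{a. (a, 0, c) \<in> Y} = {..<card {a. (a, 0, c) \<in> Y}}"
    by (rule initial_segment_eq[OF fin(1)], drule CollectD, rule CollectI, erule cl)
       (rule initial_segment_eq[OF fin(2)], drule CollectD, rule CollectI, erule cl)
  show "(a, b, c) \<in> Y \<longleftrightarrow> b < card {b. (a, b, c) \<in> Y}"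
    by (rule arg_cong[of _ _ "\<lambda>X. b \<in> X", OF eq(1), unfolded mem_Collect_eq lessThan_iff])
  show "(a, 0, c) \<in> Y \<longleftrightarrow> a < card {a. (a, 0, c) \<in> Y}"
    by (rule arg_cong[of _ _ "\<lambda>X. a \<in> X", OF eq(2), unfolded mem_Collect_eq lessThan_iff])
qed

lemma young_diagram_shape:
  assumes Y: "is_diagram r Y"
  shows "young (diagram_shape r Y) = Y"
proof -
  have cl: "(a, 0, c) \<in> Y" if "(a, b, c) \<in> Y" for a b c
    using that by (induction b) (use Y in \<open>unfold is_diagram_def, blast+\<close>)
  have cr: "c < r" if "(a, b, c) \<in> Y" for a b c
    using that Y unfolding is_diagram_def by blast
  have "(a, b, c) \<in> young (diagram_shape r Y) \<longleftrightarrow> (a, b, c) \<in> Y" for a b c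
  proof -
    have "(a, b, c) \<in> young (diagram_shape r Y) \<longleftrightarrow>
        c < r \<and> a < card {a. (a, 0, c) \<in> Y} \<and> b < card {b. (a, b, c) \<in> Y}"
      by (auto simp: young_def diagram_shape_def)
    also have "\<dots> \<longleftrightarrow> c < r \<and> (a, 0, c) \<in> Y \<and> (a, b, c) \<in> Y"
      by (simp only: diagram_rows[OF Y, symmetric])
    finally show ?thesis using cl cr by blast
  qed
  then show ?thesis by auto
qed

lemma diagram_shape_multipartition:
  assumes Y: "is_diagram r Y"
  shows "diagram_shape r Y \<in> multipartitions r (card Y)"
proof -
  have part: "is_partition (map (\<lambda>a. card {b. (a, b, c) \<in> Y}) [0..<card {a. (a, 0, c) \<in> Y}])" for c
  proof -
    have step: "card {b. (Suc a, b, c) \<in> Y} \<le> card {b. (a, b, c) \<in> Y}" for a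
    proof (rule ccontr)
      assume "\<not> ?thesis"
      then have "(Suc a, card {b. (a, b, c) \<in> Y}, c) \<in> Y"
        by (intro diagram_rows(1)[OF Y, THEN iffD2]) (simp only: not_le)
      then have "(a, card {b. (a, b, c) \<in> Y}, c) \<in> Y" using Y unfolding is_diagram_def by blast
      then have "card {b. (a, b, c) \<in> Y} < card {b. (a, b, c) \<in> Y}"
        by (rule diagram_rows(1)[OF Y, THEN iffD1])
      then show False by simp
    qed
    have "card {b. (a', b, c) \<in> Y} \<le> card {b. (a, b, c) \<in> Y}" if "a < a'" for a a'
      using lift_Suc_antimono_le[of "\<lambda>a. card {b. (a, b, c) \<in> Y}" a a'] step that by simp
    moreover have "card {b. (a, b, c) \<in> Y} \<noteq> 0" if "a < card {a. (a, 0, c) \<in> Y}" for a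
    proof -
      have "(a, 0, c) \<in> Y" using that by (rule diagram_rows(2)[OF Y, THEN iffD2])
      then have "0 < card {b. (a, b, c) \<in> Y}" by (rule diagram_rows(1)[OF Y, THEN iffD1])
      then show ?thesis by simp
    qed
    ultimately show ?thesis
      unfolding is_partition_def by (force simp: sorted_wrt_iff_nth_less)
  qed
  have "sum_list (map sum_list (diagram_shape r Y)) = card Y"
    using card_young[of "diagram_shape r Y"] by (simp add: young_diagram_shape[OF Y])
  then show ?thesis
    unfolding multipartitions_def using part by (auto simp: diagram_shape_def)
qed

lemma count_content:
  assumes "j \<in> {0..<int e}"
  shows "int (count (content e \<kappa> l) j) = res_count e \<kappa> (young l) j"
proof -
  have "res e \<kappa> \<gamma> = j \<longleftrightarrow> int e dvd int_res \<kappa> \<gamma> - j" for \<gamma>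
    using assms by (cases \<gamma>) (auto simp: res_def int_res_def mod_eq_dvd_iff[symmetric])
  then show ?thesis
    unfolding content_def res_count_def dvd_ind_def
    by (simp add: count_sum of_bool_def if_distrib cong: if_cong)
qed

lemma content_eq_image_mset: "content e \<kappa> l = image_mset (res e \<kappa>) (mset_set (young l))"
  unfolding content_def using finite_young[of l] by (induction rule: finite_induct) auto

lemma set_mset_content:
  assumes "e > 0"
  shows "set_mset (content e \<kappa> l) \<subseteq> {0..<int e}"
  using assms by (auto simp: content_eq_image_mset res_def)

lemma content_shift_funpow:
  assumes "set_mset M \<subseteq> {0..<int e}"
  shows "(content_shift e \<eta> ^^ k) M = image_mset (\<lambda>i. (i + int (k * \<eta>)) mod int e) M"
proof (induction k)
  case 0
  have "image_mset (\<lambda>i. i mod int e) M = image_mset (\<lambda>i. i) M"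
    using assms by (intro image_mset_cong) auto
  then show ?case by simp
next
  case (Suc k)
  have "((i + int (k * \<eta>)) mod int e + int \<eta>) mod int e = (i + int (Suc k * \<eta>)) mod int e" for i
    by (simp only: mod_add_left_eq) (simp add: algebra_simps)
  then show ?case
    using Suc by (simp add: content_shift_def multiset.map_comp o_def)
qed

lemma content_shift_period:
  assumes "set_mset M \<subseteq> {0..<int e}" "e = \<eta> * p"
  shows "(content_shift e \<eta> ^^ p) M = M"
proof -
  have "image_mset (\<lambda>i. (i + int (p * \<eta>)) mod int e) M = image_mset (\<lambda>i. i) M"
    using assms by (intro image_mset_cong) (auto simp: mult.commute)
  then show ?thesis unfolding content_shift_funpow[OF assms(1)] by simp
qed

section \<open>Orbits of maps of finite order\<close>

lemma orb_refl: "x \<in> orb f x"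
  unfolding orb_def by (metis funpow_0 rangeI)

lemma funpow_complement:
  assumes "(f ^^ p) x = x" "j \<le> p"
  shows "(f ^^ (p - j)) ((f ^^ j) x) = x"
proof -
  have "(f ^^ (p - j)) ((f ^^ j) x) = (f ^^ (p - j + j)) x" by (simp only: funpow_add o_apply)
  then show ?thesis using assms by simp
qed

text \<open>The map need not be injective, but on the orbit of \<open>x\<close> the period provides an inverse of
  \<open>f\<^sup>i\<close>.\<close>

lemma funpow_eq_cancel:
  assumes period: "(f ^^ p) x = x" and ij: "i \<le> j" "j \<le> p" and eq: "(f ^^ i) x = (f ^^ j) x"
  shows "(f ^^ (j - i)) x = x"
proof -
  have comp: "(f ^^ a) ((f ^^ b) x) = (f ^^ (a + b)) x" for a b by (simp add: funpow_add)
  have "(f ^^ (j - i)) x = (f ^^ (j - i)) ((f ^^ p) x)" using period by simp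
  also have "\<dots> = (f ^^ (p - i + j)) x" unfolding comp using ij by (simp add: add.commute)
  also have "\<dots> = (f ^^ (p - i)) ((f ^^ i) x)" by (simp only: comp[symmetric] eq)
  also have "\<dots> = (f ^^ p) x" unfolding comp using ij by simp
  finally show ?thesis using period by simp
qed

lemma orb_eq_image:
  assumes "(f ^^ p) x = x" "0 < p"
  shows "orb f x = (\<lambda>j. (f ^^ j) x) ` {..<p}"
proof
  show "orb f x \<subseteq> (\<lambda>j. (f ^^ j) x) ` {..<p}"
  proof
    fix y assume "y \<in> orb f x"
    then obtain j where "y = (f ^^ (j mod p)) x"
      using funpow_mod_eq[OF assms(1)] by (auto simp: orb_def)
    then show "y \<in> (\<lambda>j. (f ^^ j) x) ` {..<p}" using assms(2) by auto
  qed
qed (auto simp: orb_def)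

lemma orb_eq:
  assumes period: "(f ^^ p) x = x" "0 < p" and y: "y \<in> orb f x"
  shows "orb f y = orb f x"
proof -
  obtain j where j: "j < p" "y = (f ^^ j) x" using y unfolding orb_eq_image[OF period] by auto
  have "(f ^^ (p - j)) y = x" using j funpow_complement[OF period(1), of j] by simp
  then have "(f ^^ k) x = (f ^^ (k + (p - j))) y" for k by (simp add: funpow_add)
  moreover have "(f ^^ k) y = (f ^^ (k + j)) x" for k by (simp add: j(2) funpow_add)
  ultimately show ?thesis unfolding orb_def by (metis (no_types, lifting) image_cong image_subset_iff rangeI set_eq_subset)
qed

text \<open>A transversal of a free action of the cyclic group of order \<open>p\<close>: the powers of \<open>f\<close> below
  \<open>p\<close> identify \<open>U\<close> with \<open>p\<close> copies of \<open>X\<close>.\<close>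

lemma card_transversal:
  assumes fin: "finite U" and p: "0 < p"
    and closed: "\<And>x. x \<in> U \<Longrightarrow> f x \<in> U" and period: "\<And>x. x \<in> U \<Longrightarrow> (f ^^ p) x = x"
    and free: "\<And>x j. x \<in> U \<Longrightarrow> 0 < j \<Longrightarrow> j < p \<Longrightarrow> (f ^^ j) x \<noteq> x"
    and X: "X \<subseteq> U" "\<And>x. x \<in> U \<Longrightarrow> \<exists>y\<in>X. y \<in> orb f x"
      "\<And>x y. x \<in> X \<Longrightarrow> y \<in> X \<Longrightarrow> y \<in> orb f x \<Longrightarrow> y = x"
  shows "card U = p * card X"
proof -
  have clo: "(f ^^ j) x \<in> U" if "x \<in> U" for x j
    using that by (induction j) (auto intro: closed)
  have "bij_betw (\<lambda>(x, j). (f ^^ j) x) (X \<times> {..<p}) U"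
    unfolding bij_betw_def
  proof (intro conjI inj_onI)
    fix u v assume uv: "u \<in> X \<times> {..<p}" "v \<in> X \<times> {..<p}"
      and eq: "(case u of (x, j) \<Rightarrow> (f ^^ j) x) = (case v of (x, j) \<Rightarrow> (f ^^ j) x)"
    obtain x j y k where u: "u = (x, j)" and v: "v = (y, k)" by (metis surj_pair)
    have xy: "x \<in> X" "y \<in> X" "j < p" "k < p" "(f ^^ j) x = (f ^^ k) y"
      using uv eq u v by auto
    have xU: "x \<in> U" "y \<in> U" using xy X(1) by auto
    have "(f ^^ j) x \<in> orb f x" "(f ^^ k) y \<in> orb f y" by (auto simp: orb_def)
    then have "orb f x = orb f y"
      using orb_eq[OF period p, of x "(f ^^ j) x"] orb_eq[OF period p, of y "(f ^^ k) y"] xy X(1)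
      by (metis subsetD)
    then have "y = x" using X(3)[OF xy(1,2)] orb_refl by metis
    have "j = k"
    proof (rule ccontr)
      assume "j \<noteq> k"
      then consider "j < k" | "k < j" by linarith
      then show False
      proof cases
        case 1
        have "(f ^^ (k - j)) x = x"
          by (rule funpow_eq_cancel[OF period]) (use 1 xy X(1) \<open>y = x\<close> in auto)
        then show False using free[of x "k - j"] 1 xy xU by auto
      next
        case 2
        have "(f ^^ (j - k)) x = x"
          by (rule funpow_eq_cancel[OF period]) (use 2 xy X(1) \<open>y = x\<close> in auto)
        then show False using free[of x "j - k"] 2 xy xU by auto
      qed
    qed
    then show "u = v" using u v \<open>y = x\<close> by simp
  next
    show "(\<lambda>(x, j). (f ^^ j) x) ` (X \<times> {..<p}) = U"
    proof
      show "U \<subseteq> (\<lambda>(x, j). (f ^^ j) x) ` (X \<times> {..<p})"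
      proof
        fix x assume x: "x \<in> U"
        then obtain y where y: "y \<in> X" "y \<in> orb f x" using X(2) by blast
        have "x \<in> orb f y" using orb_eq[OF period[OF x] p y(2)] orb_refl by metis
        then obtain j where "j < p" "x = (f ^^ j) y"
          using orb_eq_image[OF period p] y(1) X(1) by blast
        then show "x \<in> (\<lambda>(x, j). (f ^^ j) x) ` (X \<times> {..<p})" using y(1) by force
      qed
    qed (use clo X(1) in auto)
  qed
  from bij_betw_same_card[OF this] show ?thesis by (simp add: card_cartesian_product mult.commute)
qed

text \<open>The least period of a point divides every period, and an orbit with fewer than \<open>p\<close> points
  has a period below \<open>p\<close>.\<close>

lemma small_orbit_period:
  assumes period: "(f ^^ p) x = x" and small: "card (orb f x) < p"
  obtains g where "0 < g" "g < p" "g dvd p" "(f ^^ g) x = x"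
proof -
  have "card ((\<lambda>j. (f ^^ j) x) ` {..<p}) = card (orb f x)"
    using orb_eq_image[OF period] small by simp
  then have "\<not> inj_on (\<lambda>j. (f ^^ j) x) {..<p}" using small card_image by fastforce
  then obtain i j where ij: "i < j" "j < p" "(f ^^ i) x = (f ^^ j) x"
    unfolding inj_on_def by (metis lessThan_iff linorder_neqE_nat)
  have ji: "(f ^^ (j - i)) x = x" by (rule funpow_eq_cancel[OF period]) (use ij in auto)
  define g where "g = (LEAST g. 0 < g \<and> (f ^^ g) x = x)"
  have ex: "0 < j - i \<and> (f ^^ (j - i)) x = x" using ij ji by simp
  have g: "0 < g" "(f ^^ g) x = x" unfolding g_def using LeastI[of "\<lambda>g. 0 < g \<and> (f ^^ g) x = x", OF ex] by auto
  have "g \<le> j - i" unfolding g_def using ex by (rule Least_le)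
  then have "g < p" using ij by linarith
  moreover have "g dvd p"
  proof (rule ccontr)
    assume "\<not> g dvd p"
    then have "0 < p mod g \<and> (f ^^ (p mod g)) x = x"
      using funpow_mod_eq[OF g(2), of p] period by (auto simp: dvd_eq_mod_eq_0)
    then have "g \<le> p mod g" unfolding g_def by (rule Least_le)
    then show False using g(1) by (metis leD mod_less_divisor)
  qed
  ultimately show ?thesis using that g by blast
qed

section \<open>A shape fixed by a proper power of the shift\<close>

lemma shift_eq_rotate:
  assumes "length x = r" "1 \<le> d" "d \<le> r"
  shows "shift r d x = rotate (r - d) x"
  using assms by (simp add: shift_def rotate_drop_take)

lemma shift_funpow:
  assumes "length x = r" "1 \<le> d" "d \<le> r"
  shows "(shift r d ^^ k) x = rotate (k * (r - d)) x"
proof (induction k)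
  case (Suc k)
  then show ?case
    using shift_eq_rotate[of "rotate (k * (r - d)) x" r d] assms by (simp add: rotate_rotate)
qed simp

lemma shift_period:
  assumes "length x = r" "1 \<le> d" "1 \<le> p" "r = d * p"
  shows "(shift r d ^^ p) x = x"
proof -
  have "p * (r - d) = r * (p - 1)" using assms(3) by (simp add: assms(4) algebra_simps diff_mult_distrib2)
  then have "(p * (r - d)) mod length x = 0" using assms(1) by simp
  then have "rotate (p * (r - d)) x = x" by (metis rotate0 rotate_conv_mod id_apply)
  then show ?thesis using shift_funpow[of x r d p] assms by simp
qed

text \<open>A residue class modulo \<open>h\<close> is the disjoint union of \<open>s\<close> classes modulo \<open>h s\<close>.\<close>

lemma dvd_ind_refine:
  assumes e: "e = h * s" and pos: "h > 0" "s > 0"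
  shows "dvd_ind h x = (\<Sum>t<s. dvd_ind e (x + int (t * h)))"
proof (cases "int h dvd x")
  case True
  then obtain y where x: "x = int h * y" by blast
  have "dvd_ind e (x + int (t * h)) = dvd_ind s (- y - int t)" for t
  proof -
    have "x + int (t * h) = int h * (y + int t)" by (simp add: x algebra_simps)
    moreover have "int s dvd y + int t \<longleftrightarrow> int s dvd - y - int t"
      using dvd_minus_iff[of "int s" "y + int t"] by (simp add: algebra_simps)
    ultimately show ?thesis using pos by (simp add: dvd_ind_def e)
  qed
  then show ?thesis using True sum_dvd_ind[OF pos(2)] by (simp add: dvd_ind_def)
next
  case False
  have "\<not> int e dvd x + int (t * h)" for t
  proof
    assume "int e dvd x + int (t * h)"
    then have "int h dvd x + int (t * h)" unfolding e by (metis dvd_mult_left of_nat_mult)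
    then show False using False by simp
  qed
  then show ?thesis using False by (simp add: dvd_ind_def)
qed

lemma charge_translate:
  assumes kappa: "\<forall>k<r. \<kappa> ((k + d) mod r) = (\<kappa> k + int \<eta>) mod int e"
    and "k + j * d < r"
  shows "int e dvd \<kappa> (k + j * d) - (\<kappa> k + int (j * \<eta>))"
  using assms(2)
proof (induction j)
  case (Suc j)
  then have "k + j * d < r" by simp
  have "\<kappa> (k + Suc j * d) = \<kappa> ((k + j * d + d) mod r)" using Suc.prems by (simp add: algebra_simps)
  also have "\<dots> = (\<kappa> (k + j * d) + int \<eta>) mod int e" using kappa \<open>k + j * d < r\<close> by blast
  finally have "int e dvd \<kappa> (k + Suc j * d) - (\<kappa> (k + j * d) + int \<eta>)"
    by (metis mod_eq_dvd_iff mod_mod_trivial)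
  from dvd_add[OF this Suc.IH[OF \<open>k + j * d < r\<close>]] show ?case by (simp add: algebra_simps)
qed simp

lemma sum_repeat_block:
  fixes f :: "nat \<Rightarrow> int"
  shows "(\<Sum>c<D * s. f c) = (\<Sum>c<D. \<Sum>t<s. f (c + t * D))"
proof -
  have "(\<Sum>c<D * s. f c) = (\<Sum>t<s. \<Sum>c = t * D..<t * D + D. f c)"
    using sum.nat_group[of f D s] by (simp add: mult.commute)
  also have "\<dots> = (\<Sum>t<s. \<Sum>c<D. f (c + t * D))"
  proof (rule sum.cong[OF refl])
    fix t
    show "sum f {t * D..<t * D + D} = (\<Sum>c<D. f (c + t * D))"
      using sum.shift_bounds_nat_ivl[of f 0 "t * D" D] by (simp add: atLeast0LessThan add.commute)
  qed
  also have "\<dots> = (\<Sum>c<D. \<Sum>t<s. f (c + t * D))" by (rule sum.swap)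
  finally show ?thesis .
qed

text \<open>A content with a short orbit is realised by a shape with a short orbit. The content is
  folded modulo \<open>h = g \<eta>\<close>, where it becomes divisible by \<open>s = p / g\<close>; saturation yields a tuple
  of \<open>D = g d\<close> partitions for the quotient, and its \<open>s\<close>-fold repetition has the given content
  because the charges of successive copies differ by \<open>h\<close>.\<close>

theorem stuttering_shape_exists:
  assumes pos: "d \<ge> 1" "\<eta> \<ge> 1" "p \<ge> 1" and e: "e = \<eta> * p" and r: "r = d * p"
    and kappa: "\<forall>k<r. \<kappa> ((k + d) mod r) = (\<kappa> k + int \<eta>) mod int e"
    and l0: "l0 \<in> multipartitions r n"
    and small: "card (orb (content_shift e \<eta>) (content e \<kappa> l0)) < p"
  obtains l g where "l \<in> multipartitions r n" "content e \<kappa> l = content e \<kappa> l0"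
    "0 < g" "g < p" "g dvd p" "(shift r d ^^ g) l = l"
proof -
  define \<alpha> where "\<alpha> = content e \<kappa> l0"
  have e0: "e > 0" using pos e by simp
  have \<alpha>_sub: "set_mset \<alpha> \<subseteq> {0..<int e}" unfolding \<alpha>_def by (rule set_mset_content[OF e0])
  obtain g where g: "0 < g" "g < p" "g dvd p" "(content_shift e \<eta> ^^ g) \<alpha> = \<alpha>"
    using small_orbit_period[OF content_shift_period[OF \<alpha>_sub e]] small unfolding \<alpha>_def by blast
  obtain s where s: "p = g * s" using g(3) by blast
  have s0: "s > 0" using s pos by (cases s) auto
  define h where "h = g * \<eta>"
  define D where "D = g * d"
  have h0: "h > 0" and D0: "D > 0" using g pos by (auto simp: h_def D_def)
  have ehs: "e = h * s" and rDs: "r = D * s" by (simp_all add: e r s h_def D_def)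
  define a where "a i = int (count \<alpha> (i mod int e))" for i
  have a_eq: "res_count e \<kappa> (young l0) i = a i" for i
  proof -
    have "a i = res_count e \<kappa> (young l0) (i mod int e)"
      unfolding a_def \<alpha>_def using e0 by (intro count_content) simp
    also have "\<dots> = res_count e \<kappa> (young l0) i"
      by (rule res_count_periodic) (simp add: mod_eq_dvd_iff[symmetric])
    finally show ?thesis by simp
  qed
  \<comment> \<open>Invariance of \<open>\<alpha>\<close> under \<open>\<sigma>\<^sup>g\<close> makes its coefficients \<open>h\<close>-periodic.\<close>
  have a_shift: "a (i + int h) = a i" for i
  proof -
    have "count \<alpha> ((i + int h) mod int e) =
        count (image_mset (\<lambda>i. (i + int h) mod int e) \<alpha>) ((i + int h) mod int e)"
      using g(4) unfolding content_shift_funpow[OF \<alpha>_sub] h_def by simp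
    also have "\<dots> = sum (count \<alpha>) {y \<in> set_mset \<alpha>. (y + int h) mod int e = (i + int h) mod int e}"
      by (auto simp: count_image_mset intro: arg_cong[of _ _ "sum (count \<alpha>)"])
    also have "{y \<in> set_mset \<alpha>. (y + int h) mod int e = (i + int h) mod int e} = {i mod int e} \<inter> set_mset \<alpha>"
    proof -
      have "(y + int h) mod int e = (i + int h) mod int e \<longleftrightarrow> y = i mod int e" if "y \<in># \<alpha>" for y
      proof -
        have "y mod int e = y" using that \<alpha>_sub by auto
        then show ?thesis using mod_eq_dvd_iff[of "y + int h" "int e" "i + int h"] mod_eq_dvd_iff[of y "int e" i] by simp
      qed
      then show ?thesis by blast
    qed
    also have "sum (count \<alpha>) ({i mod int e} \<inter> set_mset \<alpha>) = count \<alpha> (i mod int e)"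
      by (cases "i mod int e \<in># \<alpha>") (auto simp: not_in_iff)
    finally show ?thesis by (simp add: a_def)
  qed
  have a_shift': "a (i - int (t * h)) = a i" for i t
  proof (induction t)
    case (Suc t)
    then show ?case using a_shift[of "i - int (Suc t * h)"] by (simp add: algebra_simps)
  qed simp
  have kappa_t: "int e dvd \<kappa> (c + t * D) - (\<kappa> c + int (t * h))" if "c < D" "t < s" for c t
  proof -
    have "c + t * D < D + t * D" using that by simp
    also have "\<dots> \<le> r" using that mult_le_mono2[of "Suc t" s D] by (simp add: rDs mult.commute)
    finally have "c + t * D < r" .
    then show ?thesis using charge_translate[OF kappa, of c "t * g"] by (simp add: D_def h_def mult.assoc)
  qed
  have "charge_count h \<kappa> r i = int s * charge_count h \<kappa> D i" for i
  proof -
    have "dvd_ind h (\<kappa> (c + t * D) - i) = dvd_ind h (\<kappa> c - i)" if "c < D" "t < s" for c t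
    proof (rule dvd_ind_cong)
      have "int h dvd \<kappa> (c + t * D) - (\<kappa> c + int (t * h))"
        using kappa_t[OF that] unfolding ehs by (metis dvd_mult_left of_nat_mult)
      from dvd_add[OF this, of "int (t * h)"] show "int h dvd \<kappa> (c + t * D) - i - (\<kappa> c - i)"
        by (simp add: algebra_simps)
    qed
    then show ?thesis
      unfolding charge_count_def rDs sum_repeat_block by (simp add: sum_distrib_left)
  qed
  moreover have "res_count h \<kappa> (young l0) i = int s * a i" for i
  proof -
    have "res_count h \<kappa> (young l0) i = (\<Sum>t<s. res_count e \<kappa> (young l0) (i - int (t * h)))"
      unfolding res_count_def dvd_ind_refine[OF ehs h0 s0]
      by (subst sum.swap) (simp add: algebra_simps)
    then show ?thesis by (simp add: a_eq a_shift' del: of_nat_mult)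
  qed
  ultimately obtain Y where Y: "is_diagram D Y" and contY: "\<And>i. res_count h \<kappa> Y i = a i"
    using content_saturation[OF h0 D0 s0 _ is_diagram_young[OF l0]] by blast
  \<comment> \<open>Copy number \<open>t\<close> of the \<open>D\<close>-tuple occupies the components \<open>t D, ..., t D + D - 1\<close>.\<close>
  define ins where "ins = (\<lambda>((a, b, c), t). (a, b, c + t * D) :: node)"
  define Z where "Z = ins ` (Y \<times> {..<s})"
  have cD: "c < D" if "(a, b, c) \<in> Y" for a b c using that Y unfolding is_diagram_def by blast
  have memZ: "(a, b, c) \<in> Z \<longleftrightarrow> c < r \<and> (a, b, c mod D) \<in> Y" for a b c
  proof
    assume "(a, b, c) \<in> Z"
    then obtain c' t where c: "c = c' + t * D" "(a, b, c') \<in> Y" "t < s" by (auto simp: Z_def ins_def)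
    have "c' + t * D < D + t * D" using cD[OF c(2)] by simp
    also have "\<dots> \<le> r" using c(3) mult_le_mono2[of "Suc t" s D] by (simp add: rDs mult.commute)
    finally show "c < r \<and> (a, b, c mod D) \<in> Y" using c cD[OF c(2)] by simp
  next
    assume *: "c < r \<and> (a, b, c mod D) \<in> Y"
    then have "c div D < s" using D0 by (simp add: rDs less_mult_imp_div_less mult.commute)
    then have "((a, b, c mod D), c div D) \<in> Y \<times> {..<s}" using * by simp
    moreover have "ins ((a, b, c mod D), c div D) = (a, b, c)" by (simp add: ins_def)
    ultimately show "(a, b, c) \<in> Z" unfolding Z_def by (metis imageI)
  qed
  have inj: "inj_on ins (Y \<times> {..<s})"
  proof (rule inj_onI)
    fix u v assume uv: "u \<in> Y \<times> {..<s}" "v \<in> Y \<times> {..<s}" and eq': "ins u = ins v"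
    obtain a b c t a' b' c' t' where u: "u = ((a, b, c), t)" and v: "v = ((a', b', c'), t')"
      by (metis surj_pair)
    have "(a, b, c) \<in> Y" "(a', b', c') \<in> Y" and eq: "ins ((a, b, c), t) = ins ((a', b', c'), t')"
      using uv eq' u v by auto
    then have "c < D" "c' < D" using cD by blast+
    moreover have "a = a'" "b = b'" "c + t * D = c' + t' * D" using eq by (auto simp: ins_def)
    moreover from calculation have "c = c'"
      by (metis mod_less mod_mult_self1)
    ultimately show "u = v" using D0 u v by simp
  qed
  have finY: "finite Y" by (rule is_diagram_finite[OF Y])
  have Z: "is_diagram r Z"
  proof -
    have "finite Z" unfolding Z_def using finY by simp
    then show ?thesis using Y unfolding is_diagram_def memZ by blast
  qed
  have contZ: "res_count e \<kappa> Z i = a i" for i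
  proof -
    have "res_count e \<kappa> Z i = (\<Sum>(y, t)\<in>Y \<times> {..<s}. dvd_ind e (int_res \<kappa> (ins (y, t)) - i))"
      unfolding res_count_def Z_def by (subst sum.reindex[OF inj]) (simp add: case_prod_beta)
    also have "\<dots> = (\<Sum>(y, t)\<in>Y \<times> {..<s}. dvd_ind e (int_res \<kappa> y - i + int (t * h)))"
    proof (rule sum.cong[OF refl])
      fix u assume u: "u \<in> Y \<times> {..<s}"
      obtain a b c t where u_eq: "u = ((a, b, c), t)" by (metis surj_pair)
      then have "int e dvd \<kappa> (c + t * D) - (\<kappa> c + int (t * h))" using u kappa_t cD by auto
      then have "dvd_ind e (int_res \<kappa> (ins ((a, b, c), t)) - i) = dvd_ind e (int_res \<kappa> (a, b, c) - i + int (t * h))"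
        by (intro dvd_ind_cong) (simp add: ins_def int_res_def algebra_simps)
      then show "(case u of (y, t) \<Rightarrow> dvd_ind e (int_res \<kappa> (ins (y, t)) - i)) =
          (case u of (y, t) \<Rightarrow> dvd_ind e (int_res \<kappa> y - i + int (t * h)))"
        by (simp add: u_eq)
    qed
    also have "\<dots> = res_count h \<kappa> Y i"
      unfolding res_count_def dvd_ind_refine[OF ehs h0 s0] by (simp add: sum.cartesian_product)
    finally show ?thesis by (simp add: contY)
  qed
  define l where "l = diagram_shape r Z"
  have yl: "young l = Z" unfolding l_def by (rule young_diagram_shape[OF Z])
  have cont: "content e \<kappa> l = \<alpha>"
  proof (rule multiset_eqI)
    fix j
    show "count (content e \<kappa> l) j = count \<alpha> j"
    proof (cases "j \<in> {0..<int e}")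
      case True
      then have "int (count (content e \<kappa> l) j) = a j" using contZ yl count_content by simp
      then show ?thesis using True by (simp add: a_def)
    next
      case False
      then have "j \<notin># content e \<kappa> l" "j \<notin># \<alpha>" using \<alpha>_sub set_mset_content[OF e0] by blast+
      then show ?thesis by (simp add: not_in_iff)
    qed
  qed
  have size_content: "size (content e \<kappa> l') = card (young l')" for l'
    by (simp add: content_eq_image_mset)
  have "card Z = size \<alpha>" using size_content[of l] by (simp add: yl cont)
  also have "\<dots> = n" unfolding \<alpha>_def size_content card_young using l0 by (simp add: multipartitions_def)
  finally have "l \<in> multipartitions r n"
    using diagram_shape_multipartition[OF Z] by (simp add: l_def)
  moreover have "(shift r d ^^ g) l = l"
  proof -
    have len: "length l = r" by (simp add: l_def diagram_shape_def)
    have nth: "l ! c = l ! c'" if "c < r" "c' < r" "c mod D = c' mod D" for c c'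
      using that by (simp add: l_def diagram_shape_def memZ)
    have "rotate (g * (r - d)) l = l"
    proof (rule nth_equalityI)
      fix i assume "i < length (rotate (g * (r - d)) l)"
      then have i: "i < r" using len by simp
      have "g * (r - d) + D = g * r"
        using pos by (simp add: D_def diff_mult_distrib2 r)
      then have "D dvd g * (r - d) + D" unfolding rDs by simp
      then have "D dvd g * (r - d)" using dvd_add_triv_right_iff by blast
      then obtain k where "g * (r - d) = D * k" by blast
      then have "(g * (r - d) + i) mod r mod D = i mod D"
        by (simp add: rDs mod_mod_cancel)
      then have "l ! ((g * (r - d) + i) mod r) = l ! i"
        using i by (intro nth) auto
      then show "rotate (g * (r - d)) l ! i = l ! i"
        using i len by (simp add: nth_rotate add.commute)
    qed (simp add: len)
    then show ?thesis using shift_funpow[of l r d g] len pos r by simp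
  qed
  ultimately show ?thesis using that g cont \<alpha>_def by blast
qed

section \<open>The shift on standard tableaux\<close>

lemma shift_nth:
  assumes "length x = r" "1 \<le> d" "d \<le> r" "c < r"
  shows "shift r d x ! c = x ! ((c + r - d) mod r)"
  using assms by (simp add: shift_eq_rotate nth_rotate add.commute)

lemma length_shift: "length (shift r d x) = length x"
  by (simp add: shift_def)

lemma map_shift: "map f (shift r d x) = shift r d (map f x)"
  by (simp add: shift_def take_map drop_map)

text \<open>The position in a tuple of an entry that \<open>shift\<close> has moved; \<open>node_fwd\<close> below goes in the
  direction of the shift.\<close>

definition node_back :: "nat \<Rightarrow> nat \<Rightarrow> node \<Rightarrow> node" where
  "node_back r d = (\<lambda>(a, b, c). (a, b, (c + r - d) mod r))"

definition node_fwd :: "nat \<Rightarrow> nat \<Rightarrow> node \<Rightarrow> node" where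
  "node_fwd r d = (\<lambda>(a, b, c). (a, b, (c + d) mod r))"

lemma entry_shift:
  assumes "length t = r" "1 \<le> d" "d \<le> r" "c < r"
  shows "entry (shift r d t) (a, b, c) = entry t (node_back r d (a, b, c))"
  using assms by (simp add: entry_def node_back_def shift_nth)

lemma mod_back_fwd:
  assumes "d \<le> r" "c < (r::nat)"
  shows "((c + d) mod r + r - d) mod r = c" "((c + r - d) mod r + d) mod r = c"
proof -
  have "((c + d) mod r + (r - d)) mod r = (c + d + (r - d)) mod r" by (rule mod_add_left_eq)
  then show "((c + d) mod r + r - d) mod r = c" using assms by simp
  have "((c + (r - d)) mod r + d) mod r = (c + (r - d) + d) mod r" by (rule mod_add_left_eq)
  then show "((c + r - d) mod r + d) mod r = c" using assms by simp
qed

lemma node_back_young: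
  assumes "length l = r" "1 \<le> d" "d \<le> r"
  shows "bij_betw (node_back r d) (young (shift r d l)) (young l)"
proof (rule bij_betw_byWitness[where f' = "node_fwd r d"])
  have "0 < length l" using assms by simp
  then have lt: "k mod length l < length l" for k by simp
  show "\<forall>x\<in>young (shift r d l). node_fwd r d (node_back r d x) = x"
    using assms by (auto simp: young_def node_back_def node_fwd_def length_shift mod_back_fwd)
  show "\<forall>x\<in>young l. node_back r d (node_fwd r d x) = x"
    using assms by (auto simp: young_def node_back_def node_fwd_def mod_back_fwd)
  show "node_back r d ` young (shift r d l) \<subseteq> young l"
    using assms by (auto simp: young_def node_back_def length_shift shift_nth lt)
  show "node_fwd r d ` young l \<subseteq> young (shift r d l)"
    using assms by (auto simp: young_def node_fwd_def length_shift shift_nth mod_back_fwd lt)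
qed

lemma std_tableaux_length: "t \<in> std_tableaux l \<Longrightarrow> length t = length l"
  unfolding std_tableaux_def by auto

lemma shift_std_tableaux:
  assumes t: "t \<in> std_tableaux l" and l: "length l = r" "1 \<le> d" "d \<le> r"
  shows "shift r d t \<in> std_tableaux (shift r d l)"
proof -
  have lt: "length t = r" using std_tableaux_length[OF t] l(1) by simp
  note bb = node_back_young[OF l]
  have ent: "entry (shift r d t) x = entry t (node_back r d x)" if "x \<in> young (shift r d l)" for x
    using that entry_shift[OF lt l(2,3)] l(1) by (cases x) (auto simp: young_def length_shift)
  have mem: "node_back r d x \<in> young l" if "x \<in> young (shift r d l)" for x
    using that bb by (auto simp: bij_betw_def)
  have "map (map length) (shift r d t) = shift r d l"
    using t unfolding map_shift std_tableaux_def by simp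
  moreover have "bij_betw (entry (shift r d t)) (young (shift r d l)) {1..card (young (shift r d l))}"
  proof -
    have "bij_betw (entry t \<circ> node_back r d) (young (shift r d l)) {1..card (young l)}"
      using t by (intro bij_betw_trans[OF bb]) (simp add: std_tableaux_def)
    then have "bij_betw (entry (shift r d t)) (young (shift r d l)) {1..card (young l)}"
      using ent by (subst bij_betw_cong[of _ _ "entry t \<circ> node_back r d"]) auto
    then show ?thesis using bij_betw_same_card[OF bb] by simp
  qed
  moreover have "entry (shift r d t) (a, b, c) < entry (shift r d t) (a, Suc b, c)"
    if "(a, Suc b, c) \<in> young (shift r d l)" for a b c
  proof -
    have "(a, b, c) \<in> young (shift r d l)" using that by (simp add: young_def)
    then show ?thesis
      using ent ent[OF that] mem[OF that] t by (auto simp: node_back_def std_tableaux_def)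
  qed
  moreover have "entry (shift r d t) (a, b, c) < entry (shift r d t) (Suc a, b, c)"
    if "(Suc a, b, c) \<in> young (shift r d l)" for a b c
  proof -
    have *: "entry t (node_back r d (a, b, c)) < entry t (node_back r d (Suc a, b, c))"
      using mem[OF that] t by (auto simp: node_back_def std_tableaux_def)
    have "c < r" using that l(1) by (simp add: young_def length_shift)
    then show ?thesis using * entry_shift[OF lt l(2,3)] by simp
  qed
  ultimately show ?thesis unfolding std_tableaux_def by blast
qed

lemma inv_entry:
  assumes "t \<in> std_tableaux l" "x \<in> young l" "entry t x = m"
  shows "inv_into (young l) (entry t) m = x"
proof -
  have "inj_on (entry t) (young l)" using assms(1) by (auto simp: std_tableaux_def bij_betw_def)
  then show ?thesis using assms by auto
qed

lemma res_move:
  assumes "\<kappa> c' = (\<kappa> c + int \<eta>) mod int e"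
  shows "res e \<kappa> (a, b, c') = (res e \<kappa> (a, b, c) + int \<eta>) mod int e"
proof -
  have "res e \<kappa> (a, b, c') = (int b - int a + (\<kappa> c + int \<eta>)) mod int e"
    by (simp add: res_def assms mod_add_right_eq)
  also have "\<dots> = (int b - int a + \<kappa> c + int \<eta>) mod int e" by (simp only: add.assoc)
  also have "\<dots> = (res e \<kappa> (a, b, c) + int \<eta>) mod int e"
    unfolding res_def by (simp add: mod_add_left_eq)
  finally show ?thesis .
qed

lemma res_seq_shift:
  assumes t: "t \<in> std_tableaux l" and l: "length l = r" "1 \<le> d" "d \<le> r"
    and kappa: "\<forall>k<r. \<kappa> ((k + d) mod r) = (\<kappa> k + int \<eta>) mod int e"
  shows "res_seq e \<kappa> (shift r d l) (shift r d t) = map (\<lambda>i. (i + int \<eta>) mod int e) (res_seq e \<kappa> l t)"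
proof -
  have lt: "length t = r" using std_tableaux_length[OF t] l(1) by simp
  have card: "card (young (shift r d l)) = card (young l)"
    by (rule bij_betw_same_card[OF node_back_young[OF l]])
  have "res e \<kappa> (inv_into (young (shift r d l)) (entry (shift r d t)) m) =
     (res e \<kappa> (inv_into (young l) (entry t) m) + int \<eta>) mod int e" if m: "m \<in> {1..card (young l)}" for m
  proof -
    obtain a b c where x: "(a, b, c) \<in> young l" "entry t (a, b, c) = m"
    proof -
      have "entry t ` young l = {1..card (young l)}" using t by (simp add: std_tableaux_def bij_betw_def)
      then obtain x where "x \<in> young l" "m = entry t x" using m by blast
      then show ?thesis using that by (cases x) auto
    qed
    have c: "c < r" using x(1) l(1) by (simp add: young_def)
    have "(a, b, (c + d) mod r) \<in> young (shift r d l)"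
      using x(1) c l by (simp add: young_def length_shift shift_nth mod_back_fwd)
    moreover have "entry (shift r d t) (a, b, (c + d) mod r) = m"
      using entry_shift[OF lt l(2,3), of "(c + d) mod r" a b] c l x(2)
      by (simp add: node_back_def mod_back_fwd)
    ultimately have "inv_into (young (shift r d l)) (entry (shift r d t)) m = (a, b, (c + d) mod r)"
      by (intro inv_entry[OF shift_std_tableaux[OF t l]])
    moreover have "res e \<kappa> (a, b, (c + d) mod r) = (res e \<kappa> (a, b, c) + int \<eta>) mod int e"
      using res_move[of \<kappa> "(c + d) mod r" c] kappa c by simp
    ultimately show ?thesis using inv_entry[OF t x] by simp
  qed
  then show ?thesis
    unfolding res_seq_def card map_map o_def by (intro map_cong refl) (simp del: upt_Suc)
qed

lemma res_seq_mset:
  assumes "t \<in> std_tableaux l"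
  shows "mset (res_seq e \<kappa> l t) = content e \<kappa> l"
proof -
  have bij: "bij_betw (entry t) (young l) {1..card (young l)}"
    using assms by (simp add: std_tableaux_def)
  have "mset (res_seq e \<kappa> l t) =
      image_mset (res e \<kappa>) (image_mset (inv_into (young l) (entry t)) (mset_set {1..card (young l)}))"
    unfolding res_seq_def
    by (simp only: mset_map mset_upt atLeastLessThanSuc_atLeastAtMost multiset.map_comp o_def)
  also have "image_mset (inv_into (young l) (entry t)) (mset_set {1..card (young l)}) = mset_set (young l)"
    using bij_betw_inv_into[OF bij] by (subst image_mset_mset_set) (auto simp: bij_betw_def)
  finally show ?thesis by (simp add: content_eq_image_mset)
qed

lemma res_seq_residue_tuple:
  assumes "e > 0" "l \<in> multipartitions r n"
  shows "res_seq e \<kappa> l t \<in> residue_tuples e n"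
proof -
  have "card (young l) = n" using assms(2) by (simp add: card_young multipartitions_def)
  then show ?thesis using assms(1) by (auto simp: residue_tuples_def res_seq_def res_def split: prod.splits)
qed

text \<open>The nodes are numbered in the order of a numerical key that grows along rows and columns.
  The bound \<open>K\<close> exceeds all row and column indices, which makes the key injective.\<close>

lemma std_tableau_exists: "l \<in> multipartitions r n \<Longrightarrow> std_tableaux l \<noteq> {}"
proof -
  assume l: "l \<in> multipartitions r n"
  define Y where "Y = young l"
  have fin: "finite Y" unfolding Y_def by (rule finite_young)
  obtain K where K: "\<And>a b c. (a, b, c) \<in> Y \<Longrightarrow> a < K \<and> b < K"
  proof -
    have "finite ((\<lambda>(a, b, c). a + b) ` Y)" using fin by simp
    then obtain m where "\<forall>k\<in>(\<lambda>(a, b, c). a + b) ` Y. k \<le> m" using finite_nat_set_iff_bounded_le by blast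
    then show ?thesis using that[of "Suc m"] by force
  qed
  define key where "key = (\<lambda>(a, b, c). (c * K + a) * K + b)"
  define rank where "rank y = card {y' \<in> Y. key y' \<le> key y}" for y
  have inj_key: "y = y'" if "y \<in> Y" "y' \<in> Y" "key y = key y'" for y y'
  proof -
    obtain a b c a' b' c' where y: "y = (a, b, c)" "y' = (a', b', c')" by (metis surj_pair)
    have lt: "a < K" "b < K" "a' < K" "b' < K" using K that(1,2) y by blast+
    have eq: "(c * K + a) * K + b = (c' * K + a') * K + b'" using that(3) y by (simp add: key_def)
    then have "((c * K + a) * K + b) mod K = ((c' * K + a') * K + b') mod K"
      "((c * K + a) * K + b) div K = ((c' * K + a') * K + b') div K" by simp_all
    then have "b = b'" and 1: "c * K + a = c' * K + a'" using lt by simp_all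
    then have "(c * K + a) mod K = (c' * K + a') mod K" "(c * K + a) div K = (c' * K + a') div K" by simp_all
    then have "a = a'" "c = c'" using lt by simp_all
    then show ?thesis using \<open>b = b'\<close> y by simp
  qed
  have mono: "rank y < rank y'" if "y \<in> Y" "y' \<in> Y" "key y < key y'" for y y'
  proof -
    have "{y'' \<in> Y. key y'' \<le> key y} \<subseteq> {y'' \<in> Y. key y'' \<le> key y'}"
      "y' \<in> {y'' \<in> Y. key y'' \<le> key y'} - {y'' \<in> Y. key y'' \<le> key y}"
      using that by auto
    then have "{y'' \<in> Y. key y'' \<le> key y} \<subset> {y'' \<in> Y. key y'' \<le> key y'}" by blast
    then show ?thesis unfolding rank_def by (rule psubset_card_mono[rotated]) (use fin in simp)
  qed
  have bij: "bij_betw rank Y {1..card Y}"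
  proof -
    have inj: "inj_on rank Y"
      by (rule inj_onI) (metis inj_key less_irrefl linorder_neqE_nat mono)
    have "rank ` Y \<subseteq> {1..card Y}"
    proof clarsimp
      fix a b c assume y: "(a, b, c) \<in> Y"
      have "{(a, b, c)} \<subseteq> {y' \<in> Y. key y' \<le> key (a, b, c)}" using y by simp
      then have "card {(a, b, c)} \<le> rank (a, b, c)" unfolding rank_def by (rule card_mono[rotated]) (use fin in simp)
      moreover have "rank (a, b, c) \<le> card Y" unfolding rank_def by (rule card_mono) (use fin in auto)
      ultimately show "Suc 0 \<le> rank (a, b, c) \<and> rank (a, b, c) \<le> card Y" by simp
    qed
    then have "rank ` Y = {1..card Y}"
      by (intro card_subset_eq) (simp_all add: card_image[OF inj])
    then show ?thesis using inj by (simp add: bij_betw_def)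
  qed
  define t where "t = map (\<lambda>c. map (\<lambda>a. map (\<lambda>b. rank (a, b, c)) [0..<l ! c ! a]) [0..<length (l ! c)]) [0..<length l]"
  have ent: "entry t y = rank y" if "y \<in> Y" for y
    using that by (auto simp: Y_def young_def entry_def t_def)
  have "map (map length) t = l"
    by (auto simp: t_def intro!: nth_equalityI)
  moreover have "bij_betw (entry t) Y {1..card Y}"
    using bij ent by (subst bij_betw_cong[of _ _ rank]) auto
  moreover have "entry t (a, b, c) < entry t (a, Suc b, c)" if "(a, Suc b, c) \<in> Y" for a b c
  proof -
    have "(a, b, c) \<in> Y" using that by (simp add: Y_def young_def)
    then show ?thesis using that mono ent by (simp add: key_def)
  qed
  moreover have "entry t (a, b, c) < entry t (Suc a, b, c)" if "(Suc a, b, c) \<in> Y" for a b c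
  proof -
    have "(a, b, c) \<in> Y" using that is_diagram_young[OF l] unfolding Y_def is_diagram_def by blast
    moreover have "K > 0" using K[OF that] by simp
    ultimately show ?thesis using that mono ent by (simp add: key_def)
  qed
  ultimately have "t \<in> std_tableaux l" unfolding std_tableaux_def Y_def by blast
  then show ?thesis by blast
qed

lemma shift_multipartitions:
  assumes "l \<in> multipartitions r n"
  shows "shift r d l \<in> multipartitions r n"
proof -
  have "sum_list (map sum_list (shift r d l)) = sum_list (map sum_list l)"
  proof -
    have "sum_list (map sum_list l) = sum_list (map sum_list (take (r - d) l @ drop (r - d) l))"
      by (simp only: append_take_drop_id)
    then show ?thesis by (simp only: shift_def map_append sum_list_append add.commute)
  qed
  moreover have "set (shift r d l) \<subseteq> set l" 
    unfolding shift_def using set_take_subset[of "r - d" l] set_drop_subset[of "r - d" l] by auto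
  ultimately show ?thesis using assms by (auto simp: multipartitions_def length_shift)
qed

lemma content_shift_shape:
  assumes l: "length l = r" "1 \<le> d" "d \<le> r"
    and kappa: "\<forall>k<r. \<kappa> ((k + d) mod r) = (\<kappa> k + int \<eta>) mod int e"
  shows "content e \<kappa> (shift r d l) = content_shift e \<eta> (content e \<kappa> l)"
proof -
  have "mset_set (young l) = image_mset (node_back r d) (mset_set (young (shift r d l)))"
    using node_back_young[OF l] by (subst image_mset_mset_set) (auto simp: bij_betw_def)
  moreover have "res e \<kappa> x = (res e \<kappa> (node_back r d x) + int \<eta>) mod int e" if "x \<in> young (shift r d l)" for x
  proof -
    obtain a b c where x: "x = (a, b, c)" by (metis surj_pair)
    have "c < r" using that x l by (simp add: young_def length_shift)
    then have "(c + r - d) mod r < r" by simp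
    then have "\<kappa> (((c + r - d) mod r + d) mod r) = (\<kappa> ((c + r - d) mod r) + int \<eta>) mod int e"
      using kappa by blast
    then have "\<kappa> c = (\<kappa> ((c + r - d) mod r) + int \<eta>) mod int e"
      using mod_back_fwd(2)[of d r c] \<open>c < r\<close> l by simp
    then show ?thesis unfolding x node_back_def using res_move[of \<kappa> c "(c + r - d) mod r"] by simp
  qed
  ultimately show ?thesis
    unfolding content_eq_image_mset content_shift_def
    by (auto simp: multiset.map_comp finite_young intro!: image_mset_cong)
qed

lemma std_tableaux_shape: "t \<in> std_tableaux l \<Longrightarrow> map (map length) t = l"
  by (simp add: std_tableaux_def)

locale periodic_charge =
  fixes d \<eta> p n e r :: nat and \<kappa> :: "nat \<Rightarrow> int"
  assumes d_pos: "d \<ge> 1" and eta_pos: "\<eta> \<ge> 1" and p_pos: "p \<ge> 1" and n_pos: "n \<ge> 1"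
    and e_def: "e = \<eta> * p" and r_def: "r = d * p"
    and kappa: "\<forall>k<r. \<kappa> ((k + d) mod r) = (\<kappa> k + int \<eta>) mod int e"
begin

lemma e_pos: "e > 0" and p_gt_0: "0 < p" and d_le_r: "d \<le> r"
  using d_pos eta_pos p_pos by (simp_all add: e_def r_def)

abbreviation "rot \<equiv> shift r d"

lemma mp_length: "l \<in> multipartitions r n \<Longrightarrow> length l = r"
  by (simp add: multipartitions_def)

lemma rot_period: "length x = r \<Longrightarrow> (rot ^^ p) x = x"
  using shift_period d_pos p_pos r_def by blast

lemma rot_funpow_mp: "l \<in> multipartitions r n \<Longrightarrow> (rot ^^ j) l \<in> multipartitions r n"
  by (induction j) (auto intro: shift_multipartitions)

lemma rot_funpow_std:
  assumes "l \<in> multipartitions r n" "t \<in> std_tableaux l"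
  shows "(rot ^^ j) t \<in> std_tableaux ((rot ^^ j) l)"
  by (induction j) (use assms rot_funpow_mp[OF assms(1)] mp_length d_pos d_le_r in
      \<open>auto intro!: shift_std_tableaux\<close>)

lemma tableau_period:
  assumes "l \<in> multipartitions r n" "t \<in> std_tableaux l"
  shows "(rot ^^ p) t = t"
  using rot_period std_tableaux_length[OF assms(2)] mp_length[OF assms(1)] by simp

lemma shape_period: "l \<in> multipartitions r n \<Longrightarrow> (rot ^^ p) l = l"
  using rot_period mp_length by blast

text \<open>The residue of the node with entry \<open>1\<close>. Since the shift adds \<open>\<eta>\<close> to it modulo \<open>e = \<eta> p\<close>, it
  shows that the \<open>p\<close> shifts of a tableau are distinct and that exactly one of them has first
  residue below \<open>\<eta>\<close>.\<close>

definition first_residue :: "tableau \<Rightarrow> int" where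
  "first_residue t = hd (res_seq e \<kappa> (map (map length) t) t)"

lemma residue_tuple:
  "l \<in> multipartitions r n \<Longrightarrow> res_seq e \<kappa> l t \<in> residue_tuples e n"
  by (rule res_seq_residue_tuple[OF e_pos])

lemma first_residue_eq: "t \<in> std_tableaux l \<Longrightarrow> first_residue t = hd (res_seq e \<kappa> l t)"
  by (simp add: first_residue_def std_tableaux_shape)

lemma residue_tuple_hd: "i \<in> residue_tuples e n \<Longrightarrow> i \<noteq> [] \<and> hd i \<in> {0..<int e}"
  using n_pos by (cases i) (auto simp: residue_tuples_def)

lemma first_residue_range:
  assumes "l \<in> multipartitions r n" "t \<in> std_tableaux l"
  shows "first_residue t \<in> {0..<int e}"
  using residue_tuple_hd[OF residue_tuple[OF assms(1)]] first_residue_eq[OF assms(2)] by simp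

lemma first_residue_rot:
  assumes "l \<in> multipartitions r n" "t \<in> std_tableaux l"
  shows "first_residue ((rot ^^ j) t) = (first_residue t + int (j * \<eta>)) mod int e"
proof (induction j)
  case 0
  then show ?case using first_residue_range[OF assms] by simp
next
  case (Suc j)
  let ?t = "(rot ^^ j) t" and ?l = "(rot ^^ j) l"
  have l: "?l \<in> multipartitions r n" and t: "?t \<in> std_tableaux ?l"
    using rot_funpow_mp rot_funpow_std assms by blast+
  have "first_residue (rot ?t) = hd (res_seq e \<kappa> (rot ?l) (rot ?t))"
    by (rule first_residue_eq) (rule shift_std_tableaux[OF t mp_length[OF l] d_pos d_le_r])
  also have "\<dots> = (first_residue ?t + int \<eta>) mod int e"
    unfolding res_seq_shift[OF t mp_length[OF l] d_pos d_le_r kappa] first_residue_eq[OF t]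
    using residue_tuple_hd[OF residue_tuple[OF l]] by (intro hd_map) blast
  also have "\<dots> = (first_residue t + int (Suc j * \<eta>)) mod int e"
    unfolding Suc.IH mod_add_left_eq by (simp add: algebra_simps)
  finally show ?case by simp
qed

lemma orb_shape_mp: "l \<in> multipartitions r n \<Longrightarrow> \<nu> \<in> orb rot l \<Longrightarrow> \<nu> \<in> multipartitions r n"
  using rot_funpow_mp by (auto simp: orb_def)

lemma card_std_rot:
  assumes l: "l \<in> multipartitions r n" and \<nu>: "\<nu> \<in> orb rot l"
    and fin: "\<And>l. l \<in> multipartitions r n \<Longrightarrow> finite (std_tableaux l)"
  shows "card (std_tableaux \<nu>) = card (std_tableaux l)"
proof -
  have mono: "card (std_tableaux l) \<le> card (std_tableaux ((rot ^^ j) l))"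
    if l: "l \<in> multipartitions r n" and j: "j \<le> p" for l j
  proof (rule card_inj_on_le)
    show "inj_on (rot ^^ j) (std_tableaux l)"
    proof (rule inj_on_inverseI)
      fix t assume "t \<in> std_tableaux l"
      then show "(rot ^^ (p - j)) ((rot ^^ j) t) = t"
        by (rule funpow_complement[OF tableau_period[OF l] j])
    qed
    show "(rot ^^ j) ` std_tableaux l \<subseteq> std_tableaux ((rot ^^ j) l)"
      using rot_funpow_std[OF l] by blast
    show "finite (std_tableaux ((rot ^^ j) l))" by (rule fin[OF rot_funpow_mp[OF l]])
  qed
  obtain j where j: "j < p" "\<nu> = (rot ^^ j) l"
    using \<nu> orb_eq_image[OF shape_period[OF l] p_gt_0] by blast
  have "(rot ^^ (p - j)) \<nu> = l" using j funpow_complement[OF shape_period[OF l], of j] by simp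
  then show ?thesis
    using mono[OF l, of j] mono[OF orb_shape_mp[OF l \<nu>], of "p - j"] j by simp
qed

definition orbit_tableaux :: "multipartition \<Rightarrow> tableau set" where
  "orbit_tableaux l = (\<Union>\<nu>\<in>orb rot l. std_tableaux \<nu>)"

lemma finite_orb_shape: "l \<in> multipartitions r n \<Longrightarrow> finite (orb rot l)"
  using orb_eq_image[OF shape_period p_gt_0] by simp

lemma orbit_tableaux_parts:
  assumes l: "l \<in> multipartitions r n"
    and fin: "\<And>l. l \<in> multipartitions r n \<Longrightarrow> finite (std_tableaux l)"
  shows "card {t \<in> orbit_tableaux l. P t} = (\<Sum>\<nu>\<in>orb rot l. card {t \<in> std_tableaux \<nu>. P t})"
proof -
  have "{t \<in> orbit_tableaux l. P t} = (\<Union>\<nu>\<in>orb rot l. {t \<in> std_tableaux \<nu>. P t})"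
    unfolding orbit_tableaux_def by blast
  also have "card \<dots> = (\<Sum>\<nu>\<in>orb rot l. card {t \<in> std_tableaux \<nu>. P t})"
    using fin[OF orb_shape_mp[OF l]] finite_orb_shape[OF l]
    by (intro card_UN_disjoint) (auto dest: std_tableaux_shape)
  finally show ?thesis .
qed

text \<open>The tableaux with shape in the orbit of \<open>l\<close> are permuted freely by the shift, and all these
  shapes have equally many tableaux. So a property that selects one tableau from each orbit of
  tableaux is satisfied by \<open>#[l] #\<T>(l) / p\<close> of them, whatever the selection.\<close>

lemma card_orbit_transversal:
  assumes l: "l \<in> multipartitions r n"
    and fin: "\<And>l. l \<in> multipartitions r n \<Longrightarrow> finite (std_tableaux l)"
    and ex: "\<And>t. t \<in> orbit_tableaux l \<Longrightarrow> \<exists>u. P u \<and> u \<in> orb rot t"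
    and uniq: "\<And>t u. t \<in> orbit_tableaux l \<Longrightarrow> P t \<Longrightarrow> P u \<Longrightarrow> u \<in> orb rot t \<Longrightarrow> u = t"
  shows "p * (\<Sum>\<nu>\<in>orb rot l. card {t \<in> std_tableaux \<nu>. P t}) = card (orb rot l) * card (std_tableaux l)"
proof -
  have shape: "\<exists>\<nu>\<in>multipartitions r n. \<nu> \<in> orb rot l \<and> t \<in> std_tableaux \<nu>" if "t \<in> orbit_tableaux l" for t
    using that orb_shape_mp[OF l] unfolding orbit_tableaux_def by blast
  have closed: "rot t \<in> orbit_tableaux l" if t: "t \<in> orbit_tableaux l" for t
  proof -
    obtain \<nu> where \<nu>: "\<nu> \<in> multipartitions r n" "\<nu> \<in> orb rot l" "t \<in> std_tableaux \<nu>"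
      using shape[OF t] by blast
    have "rot t \<in> std_tableaux (rot \<nu>)"
      by (rule shift_std_tableaux[OF \<nu>(3) mp_length[OF \<nu>(1)] d_pos d_le_r])
    moreover have "rot \<nu> \<in> orb rot l" 
    proof -
      obtain j where "\<nu> = (rot ^^ j) l" using \<nu>(2) by (auto simp: orb_def)
      then have "rot \<nu> = (rot ^^ Suc j) l" by simp
      then show ?thesis unfolding orb_def by blast
    qed
    ultimately show ?thesis unfolding orbit_tableaux_def by blast
  qed
  have closed': "u \<in> orbit_tableaux l" if "t \<in> orbit_tableaux l" "u \<in> orb rot t" for t u
  proof -
    have "(rot ^^ j) t \<in> orbit_tableaux l" for j by (induction j) (use closed that(1) in auto)
    then show ?thesis using that(2) by (auto simp: orb_def)
  qed
  have card: "card (orbit_tableaux l) = card (orb rot l) * card (std_tableaux l)"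
    using orbit_tableaux_parts[OF l fin, of "\<lambda>_. True"] card_std_rot[OF l _ fin] by simp
  have finU: "finite (orbit_tableaux l)"
    unfolding orbit_tableaux_def using fin[OF orb_shape_mp[OF l]] finite_orb_shape[OF l] by blast
  have "card (orbit_tableaux l) = p * card {t \<in> orbit_tableaux l. P t}"
  proof (rule card_transversal[OF finU p_gt_0 closed])
    show "(rot ^^ p) t = t" if "t \<in> orbit_tableaux l" for t
      using shape[OF that] tableau_period by blast
    show "(rot ^^ j) t \<noteq> t" if t: "t \<in> orbit_tableaux l" and j: "0 < j" "j < p" for t j
    proof
      assume eq: "(rot ^^ j) t = t"
      obtain \<nu> where \<nu>: "\<nu> \<in> multipartitions r n" "t \<in> std_tableaux \<nu>" using shape[OF t] by blast
      have "(first_residue t + int (j * \<eta>)) mod int e = first_residue t mod int e"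
        using first_residue_rot[OF \<nu>, of j] first_residue_range[OF \<nu>] eq by simp
      then have "int e dvd int (j * \<eta>)" using mod_eq_dvd_iff[of "first_residue t + int (j * \<eta>)" "int e" "first_residue t"] by simp
      then have "\<eta> * p dvd \<eta> * j" unfolding e_def by (simp only: of_nat_dvd_iff mult.commute)
      then have "p dvd j" using eta_pos by simp
      then show False using j by (auto dest: dvd_imp_le)
    qed
    show "\<exists>y\<in>{t \<in> orbit_tableaux l. P t}. y \<in> orb rot t" if "t \<in> orbit_tableaux l" for t
      using ex[OF that] closed'[OF that] by blast
  qed (blast intro: uniq)+
  then show ?thesis using card orbit_tableaux_parts[OF l fin, of P] by simp
qed

lemma card_chosen_tableaux:
  assumes l: "l \<in> multipartitions r n"
    and fin: "\<And>l. l \<in> multipartitions r n \<Longrightarrow> finite (std_tableaux l)"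
    and phi: "\<And>\<nu> t. \<nu> \<in> orb rot l \<Longrightarrow> t \<in> std_tableaux \<nu> \<Longrightarrow> \<phi> (orb rot t) \<in> orb rot t"
  shows "p * card_std_tableaux0 r d \<phi> (orb rot l) = card (orb rot l) * card (std_tableaux l)"
  unfolding card_std_tableaux0_def std_tableaux0_def
proof (rule card_orbit_transversal[OF l fin])
  have orb: "orb rot u = orb rot t" if "t \<in> orbit_tableaux l" "u \<in> orb rot t" for t u
    using that orb_eq[OF tableau_period p_gt_0] orb_shape_mp[OF l] unfolding orbit_tableaux_def by blast
  fix t assume t: "t \<in> orbit_tableaux l"
  have "\<phi> (orb rot t) \<in> orb rot t" using t phi unfolding orbit_tableaux_def by blast
  then show "\<exists>u. \<phi> (orb rot u) = u \<and> u \<in> orb rot t" using orb[OF t] by metis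
  show "u = t" if "\<phi> (orb rot t) = t" "\<phi> (orb rot u) = u" "u \<in> orb rot t" for u
    using orb[OF t that(3)] that by metis
qed

lemma card_low_tableaux:
  assumes l: "l \<in> multipartitions r n"
    and fin: "\<And>l. l \<in> multipartitions r n \<Longrightarrow> finite (std_tableaux l)"
  shows "p * (\<Sum>\<nu>\<in>orb rot l. card {t \<in> std_tableaux \<nu>. first_residue t < int \<eta>}) =
    card (orb rot l) * card (std_tableaux l)"
proof (rule card_orbit_transversal[OF l fin])
  fix t assume t: "t \<in> orbit_tableaux l"
  then obtain \<nu> where \<nu>: "\<nu> \<in> multipartitions r n" "t \<in> std_tableaux \<nu>"
    using orb_shape_mp[OF l] unfolding orbit_tableaux_def by blast
  have range: "0 \<le> first_residue t" "first_residue t < int e" using first_residue_range[OF \<nu>] by auto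
  \<comment> \<open>Shifting back \<open>q\<close> times, that is, forward \<open>p - q\<close> times, brings the first residue below
    \<open>\<eta>\<close>.\<close>
  define q where "q = nat (first_residue t div int \<eta>)"
  have "0 \<le> first_residue t div int \<eta>" using range(1) by (intro div_int_pos_iff[THEN iffD2]) simp
  then have "int q = first_residue t div int \<eta>" by (simp add: q_def)
  then have q: "int q * int \<eta> + first_residue t mod int \<eta> = first_residue t"
    by (simp only: div_mult_mod_eq)
  have mod_nonneg: "0 \<le> first_residue t mod int \<eta>" using eta_pos by simp
  then have "int q * int \<eta> < int p * int \<eta>" using q range(2) by (simp add: e_def mult.commute)
  then have "q < p" using eta_pos by (simp flip: of_nat_mult)
  have "first_residue ((rot ^^ (p - q)) t) = (first_residue t + int ((p - q) * \<eta>)) mod int e"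
    by (rule first_residue_rot[OF \<nu>])
  also have "first_residue t + int ((p - q) * \<eta>) = first_residue t mod int \<eta> + int e"
    using q \<open>q < p\<close> by (simp add: e_def of_nat_diff algebra_simps)
  also have "\<dots> mod int e = first_residue t mod int \<eta> mod int e" by simp
  also have "\<dots> = first_residue t mod int \<eta>"
  proof (rule mod_pos_pos_trivial)
    show "0 \<le> first_residue t mod int \<eta>" using eta_pos by simp
    have "first_residue t mod int \<eta> < int \<eta>" using eta_pos by simp
    also have "int \<eta> \<le> int e" unfolding e_def of_nat_le_iff using p_pos by simp
    finally show "first_residue t mod int \<eta> < int e" .
  qed
  finally have "first_residue ((rot ^^ (p - q)) t) < int \<eta>" using eta_pos by simp
  then show "\<exists>u. first_residue u < int \<eta> \<and> u \<in> orb rot t" by (auto simp: orb_def)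
  show "u = t" if low: "first_residue t < int \<eta>" "first_residue u < int \<eta>" and u: "u \<in> orb rot t" for u
  proof -
    obtain j where j: "j < p" "u = (rot ^^ j) t"
      using u orb_eq_image[OF tableau_period[OF \<nu>] p_gt_0] by blast
    have "int (j * \<eta>) + int \<eta> \<le> int e"
    proof -
      have "Suc j * \<eta> \<le> p * \<eta>" using j(1) by (intro mult_le_mono1) simp
      then show ?thesis by (simp add: e_def mult.commute flip: of_nat_add of_nat_mult)
    qed
    then have "(first_residue t + int (j * \<eta>)) mod int e = first_residue t + int (j * \<eta>)"
      using range low(1) by (intro mod_pos_pos_trivial) auto
    then have "int (j * \<eta>) < int \<eta>" using first_residue_rot[OF \<nu>, of j] low(2) j(2) range by simp
    then have "j = 0" using eta_pos by (cases j) (auto simp flip: of_nat_mult)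
    then show ?thesis using j by simp
  qed
qed

end

section \<open>Counting cellular bases\<close>

lemma cellular_basis_eq_image:
  "cellular_basis \<Lambda> \<T> c = (\<lambda>(l, s, t). c l s t) ` (SIGMA l:\<Lambda>. \<T> l \<times> \<T> l)"
  unfolding cellular_basis_def by force

lemma card_cellular_basis:
  assumes "cellular_datum scale A \<Lambda> le \<T> c"
  shows "finite (cellular_basis \<Lambda> \<T> c)" "card (cellular_basis \<Lambda> \<T> c) = (\<Sum>l\<in>\<Lambda>. (card (\<T> l))\<^sup>2)"
proof -
  have fin: "finite \<Lambda>" "\<And>l. l \<in> \<Lambda> \<Longrightarrow> finite (\<T> l)"
    and inj: "inj_on (\<lambda>(l, s, t). c l s t) {(l, s, t). l \<in> \<Lambda> \<and> s \<in> \<T> l \<and> t \<in> \<T> l}"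
    using assms by (auto simp: cellular_datum_def)
  have "{(l, s, t). l \<in> \<Lambda> \<and> s \<in> \<T> l \<and> t \<in> \<T> l} = (SIGMA l:\<Lambda>. \<T> l \<times> \<T> l)" by auto
  with inj have inj: "inj_on (\<lambda>(l, s, t). c l s t) (SIGMA l:\<Lambda>. \<T> l \<times> \<T> l)" by simp
  show "finite (cellular_basis \<Lambda> \<T> c)" unfolding cellular_basis_eq_image using fin by auto
  show "card (cellular_basis \<Lambda> \<T> c) = (\<Sum>l\<in>\<Lambda>. (card (\<T> l))\<^sup>2)"
    unfolding cellular_basis_eq_image card_image[OF inj] using fin
    by (simp add: card_SigmaI card_cartesian_product power2_eq_square)
qed

lemma cellular_datum_eqD:
  assumes "cellular_datum scale A \<Lambda> le \<T> c" "c l s t = c l' s' t'"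
    "l \<in> \<Lambda>" "s \<in> \<T> l" "t \<in> \<T> l" "l' \<in> \<Lambda>" "s' \<in> \<T> l'" "t' \<in> \<T> l'"
  shows "l = l' \<and> s = s' \<and> t = t'"
proof -
  have "inj_on (\<lambda>(l, s, t). c l s t) {(l, s, t). l \<in> \<Lambda> \<and> s \<in> \<T> l \<and> t \<in> \<T> l}"
    using assms(1) by (auto simp: cellular_datum_def)
  from inj_onD[OF this, of "(l, s, t)" "(l', s', t')"] show ?thesis using assms(2-) by simp
qed

text \<open>The basis elements with two indices in the same cell are exchanged in pairs, and those with
  equal indices are fixed.\<close>

lemma card_star_fixed_cellular_basis:
  assumes cd: "cellular_datum scale A \<Lambda> le \<T> c"
    and star: "\<forall>l\<in>\<Lambda>. \<forall>s\<in>\<T> l. \<forall>t\<in>\<T> l. star (c l s t) = c l t s"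
  shows "card {x \<in> cellular_basis \<Lambda> \<T> c. star x = x} = (\<Sum>l\<in>\<Lambda>. card (\<T> l))"
proof -
  have fin: "finite \<Lambda>" "\<And>l. l \<in> \<Lambda> \<Longrightarrow> finite (\<T> l)" using cd by (auto simp: cellular_datum_def)
  have "{x \<in> cellular_basis \<Lambda> \<T> c. star x = x} = (\<lambda>(l, s). c l s s) ` (SIGMA l:\<Lambda>. \<T> l)"
  proof (intro equalityI subsetI)
    fix x assume "x \<in> {x \<in> cellular_basis \<Lambda> \<T> c. star x = x}"
    then obtain l s t where x: "x = c l s t" "l \<in> \<Lambda>" "s \<in> \<T> l" "t \<in> \<T> l" and "star x = x"
      by (auto simp: cellular_basis_def)
    then have "c l t s = c l s t" using star by metis
    then have "s = t" using cellular_datum_eqD[OF cd] x(2-) by blast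
    then show "x \<in> (\<lambda>(l, s). c l s s) ` (SIGMA l:\<Lambda>. \<T> l)" using x by force
  next
    fix x assume "x \<in> (\<lambda>(l, s). c l s s) ` (SIGMA l:\<Lambda>. \<T> l)"
    then show "x \<in> {x \<in> cellular_basis \<Lambda> \<T> c. star x = x}"
      using star by (auto simp: cellular_basis_def)
  qed
  moreover have "inj_on (\<lambda>(l, s). c l s s) (SIGMA l:\<Lambda>. \<T> l)"
    by (rule inj_onI) (auto dest!: cellular_datum_eqD[OF cd])
  ultimately show ?thesis using fin by (simp add: card_image card_SigmaI)
qed

text \<open>The cells \<open>L \<omega> j\<close> may coincide. If the squares of their sizes, counted without repetition,
  still reach the sum over all pairs \<open>(\<omega>, j)\<close>, then every repeated cell has size zero, and the
  sizes themselves also sum to the value counted with repetition.\<close>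

lemma square_sum_forces_injective:
  fixes N D :: "'a \<Rightarrow> nat" and w :: "'l \<Rightarrow> nat"
  assumes fin: "finite Orbs"
    and cover: "{L \<omega> j | \<omega> j. \<omega> \<in> Orbs \<and> j \<in> {1..D \<omega>}} = \<Lambda>"
    and w: "\<And>\<omega> j. \<omega> \<in> Orbs \<Longrightarrow> j \<in> {1..D \<omega>} \<Longrightarrow> w (L \<omega> j) = N \<omega>"
    and squares: "(\<Sum>\<omega>\<in>Orbs. D \<omega> * (N \<omega>)\<^sup>2) \<le> (\<Sum>l\<in>\<Lambda>. (w l)\<^sup>2)"
  shows "(\<Sum>l\<in>\<Lambda>. w l) = (\<Sum>\<omega>\<in>Orbs. D \<omega> * N \<omega>)"
proof -
  define Q where "Q = (SIGMA \<omega>:Orbs. {1..D \<omega>})"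
  define g where "g = (\<lambda>(\<omega>, j). L \<omega> j)"
  have finQ: "finite Q" unfolding Q_def using fin by simp
  have img: "\<Lambda> = g ` Q" unfolding cover[symmetric] Q_def g_def by force
  have sumQ: "(\<Sum>x\<in>Q. f (w (g x))) = (\<Sum>\<omega>\<in>Orbs. D \<omega> * f (N \<omega>))" for f :: "nat \<Rightarrow> nat"
  proof -
    have "(\<Sum>x\<in>Q. f (w (g x))) = (\<Sum>\<omega>\<in>Orbs. \<Sum>j\<in>{1..D \<omega>}. f (w (L \<omega> j)))"
      unfolding Q_def g_def by (subst sum.Sigma) (use fin in \<open>auto intro!: sum.cong\<close>)
    also have "\<dots> = (\<Sum>\<omega>\<in>Orbs. \<Sum>j\<in>{1..D \<omega>}. f (N \<omega>))"
      by (intro sum.cong refl) (simp add: w)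
    finally show ?thesis by simp
  qed
  obtain Q' where Q': "Q' \<subseteq> Q" "\<Lambda> = g ` Q'" "inj_on g Q'"
    using subset_image_inj[of \<Lambda> g Q] img by blast
  have sub: "(\<Sum>l\<in>\<Lambda>. f (w l)) = (\<Sum>x\<in>Q'. f (w (g x)))" for f :: "nat \<Rightarrow> nat"
    unfolding Q'(2) by (subst sum.reindex[OF Q'(3)]) simp
  have split: "(\<Sum>x\<in>Q. f (w (g x))) = (\<Sum>x\<in>Q - Q'. f (w (g x))) + (\<Sum>x\<in>Q'. f (w (g x)))" for f :: "nat \<Rightarrow> nat"
    by (rule sum.subset_diff[OF Q'(1) finQ])
  have "(\<Sum>x\<in>Q - Q'. (w (g x))\<^sup>2) = 0"
    using squares split[of "\<lambda>m. m\<^sup>2"] sub[of "\<lambda>m. m\<^sup>2"] sumQ[of "\<lambda>m. m\<^sup>2"] by simp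
  then have "(\<Sum>x\<in>Q - Q'. w (g x)) = 0" using finQ by simp
  then show ?thesis using split[of "\<lambda>m. m"] sub[of "\<lambda>m. m"] sumQ[of "\<lambda>m. m"] by simp
qed

section \<open>The fixed subalgebra of a shift orbit of blocks\<close>

text \<open>The properties of the algebra that the argument rests on: the automorphism translates the
  idempotents, the anti-automorphism fixes them, and the cellular basis is compatible with both.\<close>

locale shifted_cellular_algebra = periodic_charge d \<eta> p n e r \<kappa> + assoc_algebra scale
  for d \<eta> p n e r :: nat and \<kappa> :: "nat \<Rightarrow> int" and scale :: "'f::field \<Rightarrow> 'h::ring_1 \<Rightarrow> 'h" +
  fixes \<sigma> star :: "'h \<Rightarrow> 'h" and \<epsilon> :: "int list \<Rightarrow> 'h"
    and le :: "multipartition rel" and c :: "multipartition \<Rightarrow> tableau \<Rightarrow> tableau \<Rightarrow> 'h"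
  assumes sigma: "automorphism_on scale UNIV \<sigma>" and sigma_period: "\<sigma> ^^ p = id"
    and idem: "\<forall>i\<in>residue_tuples e n. \<forall>j\<in>residue_tuples e n. \<epsilon> i * \<epsilon> j = (if i = j then \<epsilon> i else 0)"
    and sigma_idem: "\<forall>i\<in>residue_tuples e n. \<sigma> (\<epsilon> i) = \<epsilon> (map (\<lambda>k. (k - int \<eta>) mod int e) i)"
    and star_anti: "anti_automorphism_on scale UNIV star"
    and star_idem: "\<forall>i\<in>residue_tuples e n. star (\<epsilon> i) = \<epsilon> i"
    and cell: "cellular_datum scale UNIV (multipartitions r n) le std_tableaux c"
    and star_cell: "\<forall>l\<in>multipartitions r n. \<forall>s\<in>std_tableaux l. \<forall>t\<in>std_tableaux l. star (c l s t) = c l t s"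
    and cell_corner: "\<forall>l\<in>multipartitions r n. \<forall>s\<in>std_tableaux l. \<forall>t\<in>std_tableaux l.
         \<exists>h. c l s t = \<epsilon> (res_seq e \<kappa> l s) * h * \<epsilon> (res_seq e \<kappa> l t)"
begin

lemma sigma_add: "\<sigma> (x + y) = \<sigma> x + \<sigma> y" and sigma_mult: "\<sigma> (x * y) = \<sigma> x * \<sigma> y"
  using sigma by (auto simp: automorphism_on_def linear_bij_on_def)

lemma sigma_sum: "\<sigma> (sum f A) = (\<Sum>x\<in>A. \<sigma> (f x))"
proof -
  have "\<sigma> 0 = 0" using sigma_add[of 0 0] by simp
  then show ?thesis by (induction A rule: infinite_finite_induct) (auto simp: sigma_add)
qed

lemma sigma_funpow_mult: "(\<sigma> ^^ j) (x * y) = (\<sigma> ^^ j) x * (\<sigma> ^^ j) y"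
  by (induction j) (auto simp: sigma_mult)

lemma fin_mp: "finite (multipartitions r n)"
  and fin_std: "l \<in> multipartitions r n \<Longrightarrow> finite (std_tableaux l)"
  using cell by (auto simp: cellular_datum_def)

text \<open>The effect of \<open>\<sigma>\<^sup>j\<close> on the residue sequence that labels an idempotent.\<close>

definition translate :: "nat \<Rightarrow> int list \<Rightarrow> int list" where
  "translate j i = map (\<lambda>k. (k - int (j * \<eta>)) mod int e) i"

lemma translate_tuple: "i \<in> residue_tuples e n \<Longrightarrow> translate j i \<in> residue_tuples e n"
  using e_pos by (auto simp: residue_tuples_def translate_def)

lemma translate_0: "i \<in> residue_tuples e n \<Longrightarrow> translate 0 i = i"
  by (auto simp: residue_tuples_def translate_def intro!: map_idI)

lemma sigma_funpow_idem:
  assumes "i \<in> residue_tuples e n"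
  shows "(\<sigma> ^^ j) (\<epsilon> i) = \<epsilon> (translate j i)"
proof (induction j)
  case 0
  then show ?case using translate_0[OF assms] by simp
next
  case (Suc j)
  have "map (\<lambda>k. (k - int \<eta>) mod int e) (translate j i) = translate (Suc j) i"
    by (simp add: translate_def mod_diff_left_eq algebra_simps)
  then show ?case using Suc sigma_idem translate_tuple[OF assms, of j] by simp
qed

lemma translate_hd:
  assumes "i \<in> residue_tuples e n"
  shows "hd (translate j i) = (hd i - int (j * \<eta>)) mod int e"
  using residue_tuple_hd[OF assms] by (simp add: translate_def hd_map)

lemma translate_translate: "translate j (translate k i) = translate (j + k) i"
  by (simp add: translate_def mod_diff_left_eq algebra_simps)

lemma translate_fixD:
  assumes i: "i \<in> residue_tuples e n" and fix_i: "translate j i = i"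
  shows "p dvd j"
proof -
  have "(hd i - int (j * \<eta>)) mod int e = hd i mod int e"
    using translate_hd[OF i, of j] residue_tuple_hd[OF i] fix_i by simp
  then have "int e dvd int (j * \<eta>)"
    using mod_eq_dvd_iff[of "hd i - int (j * \<eta>)" "int e" "hd i"] by simp
  then have "\<eta> * p dvd \<eta> * j" unfolding e_def by (simp only: of_nat_dvd_iff mult.commute)
  then show ?thesis using eta_pos by simp
qed

lemma translate_fix_iff:
  assumes "i \<in> residue_tuples e n" "j < p"
  shows "translate j i = i \<longleftrightarrow> j = 0"
proof
  assume "translate j i = i"
  then have "p dvd j" by (rule translate_fixD[OF assms(1)])
  then show "j = 0" using assms(2) by (metis dvd_imp_le gr0I leD)
qed (simp add: translate_0[OF assms(1)])

lemma translate_low: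
  assumes i: "i \<in> residue_tuples e n" and low: "hd i < int \<eta>" and j: "j < p"
    and low': "hd (translate j i) < int \<eta>"
  shows "j = 0"
proof (rule ccontr)
  assume "j \<noteq> 0"
  have range: "0 \<le> hd i" using residue_tuple_hd[OF i] by simp
  have "int (j * \<eta>) + int \<eta> \<le> int e"
  proof -
    have "Suc j * \<eta> \<le> p * \<eta>" using j by (intro mult_le_mono1) simp
    then show ?thesis by (simp add: e_def mult.commute flip: of_nat_add of_nat_mult)
  qed
  moreover have "int \<eta> \<le> int (j * \<eta>)" using \<open>j \<noteq> 0\<close> by (simp only: of_nat_le_iff) simp
  ultimately have "(hd i - int (j * \<eta>) + int e) mod int e = hd i - int (j * \<eta>) + int e"
    using range low by (intro mod_pos_pos_trivial) linarith+
  then have "hd (translate j i) = hd i - int (j * \<eta>) + int e" using translate_hd[OF i, of j] by simp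
  then show False using low' range \<open>int (j * \<eta>) + int \<eta> \<le> int e\<close> by linarith
qed

text \<open>Orbits are formed with nonnegative powers of the content shift; modulo \<open>e = \<eta> p\<close>,
  translating by \<open>- j \<eta>\<close> is shifting forward \<open>p - j\<close> times.\<close>

lemma mset_translate:
  assumes "i \<in> residue_tuples e n" "j \<le> p"
  shows "mset (translate j i) = (content_shift e \<eta> ^^ (p - j)) (mset i)"
proof -
  have "(k - int (j * \<eta>)) mod int e = (k + int ((p - j) * \<eta>)) mod int e" for k
  proof -
    have "k + int ((p - j) * \<eta>) = k - int (j * \<eta>) + int e"
      using assms(2) by (simp add: e_def of_nat_diff algebra_simps)
    then show ?thesis by (simp only: mod_add_self2)
  qed
  moreover have "set_mset (mset i) \<subseteq> {0..<int e}" using assms(1) by (simp add: residue_tuples_def)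
  ultimately show ?thesis by (simp add: content_shift_funpow translate_def)
qed

lemma sigma_cell:
  assumes "l \<in> multipartitions r n" "s \<in> std_tableaux l" "t \<in> std_tableaux l"
  obtains h where "(\<sigma> ^^ j) (c l s t) =
    \<epsilon> (translate j (res_seq e \<kappa> l s)) * h * \<epsilon> (translate j (res_seq e \<kappa> l t))"
proof -
  obtain h where "c l s t = \<epsilon> (res_seq e \<kappa> l s) * h * \<epsilon> (res_seq e \<kappa> l t)"
    using cell_corner assms by blast
  then have "(\<sigma> ^^ j) (c l s t) =
    \<epsilon> (translate j (res_seq e \<kappa> l s)) * (\<sigma> ^^ j) h * \<epsilon> (translate j (res_seq e \<kappa> l t))"
    using sigma_funpow_idem residue_tuple[OF assms(1)] by (simp add: sigma_funpow_mult)
  then show ?thesis by (rule that)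
qed

lemma sigma_cell_right:
  assumes l: "l \<in> multipartitions r n" and st: "s \<in> std_tableaux l" "t \<in> std_tableaux l"
    and i: "i \<in> residue_tuples e n"
  shows "(\<sigma> ^^ j) (c l s t) * \<epsilon> i = (if translate j (res_seq e \<kappa> l t) = i then (\<sigma> ^^ j) (c l s t) else 0)"
proof -
  obtain h where h: "(\<sigma> ^^ j) (c l s t) =
    \<epsilon> (translate j (res_seq e \<kappa> l s)) * h * \<epsilon> (translate j (res_seq e \<kappa> l t))"
    using sigma_cell[OF l st] by blast
  show ?thesis
    unfolding h mult.assoc using idem translate_tuple[OF residue_tuple[OF l]] i by auto
qed

lemma sigma_cell_left:
  assumes l: "l \<in> multipartitions r n" and st: "s \<in> std_tableaux l" "t \<in> std_tableaux l"
    and i: "i \<in> residue_tuples e n"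
  shows "\<epsilon> i * (\<sigma> ^^ j) (c l s t) = (if translate j (res_seq e \<kappa> l s) = i then (\<sigma> ^^ j) (c l s t) else 0)"
proof -
  obtain h where h: "(\<sigma> ^^ j) (c l s t) =
    \<epsilon> (translate j (res_seq e \<kappa> l s)) * h * \<epsilon> (translate j (res_seq e \<kappa> l t))"
    using sigma_cell[OF l st] by blast
  have "\<epsilon> i * \<epsilon> (translate j (res_seq e \<kappa> l s)) =
      (if translate j (res_seq e \<kappa> l s) = i then \<epsilon> (translate j (res_seq e \<kappa> l s)) else 0)"
    using idem translate_tuple[OF residue_tuple[OF l]] i by auto
  then show ?thesis
    unfolding h by (simp add: mult.assoc[symmetric])
qed

lemma mu_corner:
  assumes l: "l \<in> multipartitions r n" and st: "s \<in> std_tableaux l" "t \<in> std_tableaux l"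
    and i: "i \<in> residue_tuples e n" and i': "i' \<in> residue_tuples e n"
  shows "\<epsilon> i * mu p \<sigma> (c l s t) * \<epsilon> i' = (\<Sum>j<p. if translate j (res_seq e \<kappa> l s) = i \<and>
      translate j (res_seq e \<kappa> l t) = i' then (\<sigma> ^^ j) (c l s t) else 0)"
  unfolding mu_def sum_distrib_left sum_distrib_right
  by (intro sum.cong refl) (simp add: sigma_cell_left[OF l st i] sigma_cell_right[OF l st i'])

text \<open>The summands \<open>\<sigma>\<^sup>j(c\<^sub>s\<^sub>t)\<close> of the average lie in different corners of the algebra, because
  the \<open>p\<close> translates of a residue sequence are distinct.\<close>

lemma mu_corner_self:
  assumes l: "l \<in> multipartitions r n" and st: "s \<in> std_tableaux l" "t \<in> std_tableaux l"
  shows "\<epsilon> (res_seq e \<kappa> l s) * mu p \<sigma> (c l s t) * \<epsilon> (res_seq e \<kappa> l t) = c l s t"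
proof -
  have "translate j (res_seq e \<kappa> l s) = res_seq e \<kappa> l s \<and> translate j (res_seq e \<kappa> l t) = res_seq e \<kappa> l t
      \<longleftrightarrow> j = 0" if "j < p" for j
    using translate_fix_iff[OF residue_tuple[OF l] that] by blast
  then have "\<epsilon> (res_seq e \<kappa> l s) * mu p \<sigma> (c l s t) * \<epsilon> (res_seq e \<kappa> l t) =
      (\<Sum>j<p. if j = 0 then (\<sigma> ^^ j) (c l s t) else 0)"
    unfolding mu_corner[OF l st residue_tuple[OF l] residue_tuple[OF l]]
    by (intro sum.cong refl) simp
  then show ?thesis using p_gt_0 by simp
qed

lemma cell_nonzero:
  assumes "l \<in> multipartitions r n" "s \<in> std_tableaux l" "t \<in> std_tableaux l"
  shows "c l s t \<noteq> 0"
proof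
  assume "c l s t = 0"
  then have "0 \<in> cellular_basis (multipartitions r n) std_tableaux c"
    using assms unfolding cellular_basis_def by force
  then show False using cell dependent_zero by (auto simp: cellular_datum_def)
qed

text \<open>If \<open>\<mu>(c\<^sub>s\<^sub>t)\<close> is fixed, its corner between the idempotents of \<open>t\<close> and \<open>s\<close> is \<open>c\<^sub>t\<^sub>s\<close>, which
  is not zero. So some translation by \<open>j \<eta>\<close> exchanges the residue sequences of \<open>s\<close> and \<open>t\<close>;
  applied twice it is trivial, and \<open>p\<close> being odd it is trivial itself.\<close>

lemma star_fixed_mu:
  assumes l: "l \<in> multipartitions r n" and st: "s \<in> std_tableaux l" "t \<in> std_tableaux l"
    and "odd p" and fixed: "star (mu p \<sigma> (c l s t)) = mu p \<sigma> (c l s t)"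
  shows "s = t"
proof -
  let ?i = "res_seq e \<kappa> l s" and ?i' = "res_seq e \<kappa> l t" and ?x = "mu p \<sigma> (c l s t)"
  have star_mult: "star (x * y) = star y * star x" for x y
    using star_anti by (auto simp: anti_automorphism_on_def)
  have "c l t s = star (\<epsilon> ?i * ?x * \<epsilon> ?i')"
    using star_cell l st by (simp add: mu_corner_self[OF l st])
  also have "\<dots> = \<epsilon> ?i' * ?x * \<epsilon> ?i"
    using star_idem residue_tuple[OF l] fixed by (simp add: star_mult mult.assoc)
  finally have eq: "c l t s = \<epsilon> ?i' * ?x * \<epsilon> ?i" .
  then have "(\<Sum>j<p. if translate j ?i = ?i' \<and> translate j ?i' = ?i then (\<sigma> ^^ j) (c l s t) else 0) \<noteq> 0"
    using cell_nonzero[OF l st(2,1)]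
    unfolding mu_corner[OF l st residue_tuple[OF l, of t] residue_tuple[OF l, of s]] by argo
  then obtain j where j: "j < p" "translate j ?i = ?i'" "translate j ?i' = ?i"
  proof -
    obtain j where "j \<in> {..<p}" "(if translate j ?i = ?i' \<and> translate j ?i' = ?i then (\<sigma> ^^ j) (c l s t) else 0) \<noteq> 0"
      using sum.not_neutral_contains_not_neutral[OF \<open>_ \<noteq> 0\<close>] by blast
    then show ?thesis using that by (auto split: if_splits)
  qed
  have "translate (j + j) ?i = ?i" using j translate_translate[of j j ?i] by simp
  then have "p dvd 2 * j" using translate_fixD[OF residue_tuple[OF l]] by (simp add: mult_2)
  moreover have "coprime p 2" using \<open>odd p\<close> by simp
  ultimately have "p dvd j" using coprime_dvd_mult_right_iff by blast
  then have "j = 0" using j(1) by (metis dvd_imp_le gr0I leD)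
  then have "?i = ?i'" using j(2) translate_0[OF residue_tuple[OF l]] by simp
  then have "c l t s = c l s t" using eq mu_corner_self[OF l st] by simp
  then show ?thesis using cellular_datum_eqD[OF cell, of l t s l s t] l st by blast
qed

text \<open>One residue sequence from each orbit of translations starts below \<open>\<eta>\<close>, so this idempotent
  retains exactly one of the summands of an average \<open>\<mu>(c\<^sub>s\<^sub>t)\<close>.\<close>

definition low_idem :: 'h where
  "low_idem = (\<Sum>i\<in>{i \<in> residue_tuples e n. hd i < int \<eta>}. \<epsilon> i)"

lemma finite_residue_tuples: "finite (residue_tuples e n)"
  unfolding residue_tuples_def using finite_lists_length_eq[of "{0..<int e}" n] by (simp add: conj_commute)

lemma mu_low_idem:
  assumes l: "l \<in> multipartitions r n" and st: "s \<in> std_tableaux l" "t \<in> std_tableaux l"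
    and low: "first_residue t < int \<eta>"
  shows "mu p \<sigma> (c l s t) * low_idem = c l s t"
proof -
  let ?i = "res_seq e \<kappa> l t"
  have i: "?i \<in> residue_tuples e n" by (rule residue_tuple[OF l])
  have hd_low: "hd ?i < int \<eta>" using low first_residue_eq[OF st(2)] by simp
  have "(\<sigma> ^^ j) (c l s t) * low_idem = (if j = 0 then (\<sigma> ^^ j) (c l s t) else 0)" if j: "j < p" for j
  proof -
    have "(\<sigma> ^^ j) (c l s t) * low_idem =
       (\<Sum>i'\<in>{i \<in> residue_tuples e n. hd i < int \<eta>}. if translate j ?i = i' then (\<sigma> ^^ j) (c l s t) else 0)"
      unfolding low_idem_def sum_distrib_left
      by (intro sum.cong refl) (simp add: sigma_cell_right[OF l st])
    also have "\<dots> = (if hd (translate j ?i) < int \<eta> then (\<sigma> ^^ j) (c l s t) else 0)"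
      using finite_residue_tuples translate_tuple[OF i, of j] by simp
    also have "hd (translate j ?i) < int \<eta> \<longleftrightarrow> j = 0"
      using translate_low[OF i hd_low j] translate_0[OF i] hd_low by auto
    finally show ?thesis .
  qed
  then have "mu p \<sigma> (c l s t) * low_idem = (\<Sum>j<p. if j = 0 then (\<sigma> ^^ j) (c l s t) else 0)"
    unfolding mu_def sum_distrib_right by (intro sum.cong refl) simp
  then show ?thesis using p_gt_0 by simp
qed

lemma mu_fixed: "\<sigma> (mu p \<sigma> x) = mu p \<sigma> x"
proof -
  have "\<sigma> (mu p \<sigma> x) = (\<Sum>j<p. (\<sigma> ^^ Suc j) x)" by (simp add: mu_def sigma_sum)
  also have "\<dots> = (\<Sum>j<p. (\<sigma> ^^ j) x)"
  proof (cases p)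
    case (Suc k)
    have "(\<Sum>j<Suc k. (\<sigma> ^^ Suc j) x) = (\<Sum>j<k. (\<sigma> ^^ Suc j) x) + x"
      using sigma_period by (simp add: Suc del: funpow.simps)
    also have "\<dots> = (\<Sum>j<Suc k. (\<sigma> ^^ j) x)"
      by (subst sum.lessThan_Suc_shift) (simp add: add.commute)
    finally show ?thesis using Suc by simp
  qed simp
  finally show ?thesis by (simp add: mu_def)
qed

lemma multipartitions_orbD:
  assumes "l \<in> multipartitions_orb e \<eta> \<kappa> r n \<alpha>"
  shows "l \<in> multipartitions r n" "content e \<kappa> l \<in> orb (content_shift e \<eta>) \<alpha>"
  using assms by (auto simp: multipartitions_orb_def)

lemma mu_in_fixed_block:
  assumes lP: "l \<in> multipartitions_orb e \<eta> \<kappa> r n \<alpha>" and st: "s \<in> std_tableaux l" "t \<in> std_tableaux l"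
  shows "mu p \<sigma> (c l s t) \<in> fixed_block_orb scale e \<eta> n \<epsilon> \<sigma> \<alpha>"
proof -
  note l = multipartitions_orbD[OF lP]
  have "(\<sigma> ^^ j) (c l s t) \<in> block_orb scale e \<eta> n \<epsilon> \<alpha>" if "j < p" for j
  proof -
    define \<beta> where "\<beta> = (content_shift e \<eta> ^^ (p - j)) (content e \<kappa> l)"
    obtain k where "content e \<kappa> l = (content_shift e \<eta> ^^ k) \<alpha>" using l(2) by (auto simp: orb_def)
    then have "\<beta> = (content_shift e \<eta> ^^ (p - j + k)) \<alpha>" by (simp add: \<beta>_def funpow_add)
    then have \<beta>: "\<beta> \<in> orb (content_shift e \<eta>) \<alpha>" unfolding orb_def by blast
    obtain h where h: "(\<sigma> ^^ j) (c l s t) =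
      \<epsilon> (translate j (res_seq e \<kappa> l s)) * h * \<epsilon> (translate j (res_seq e \<kappa> l t))"
      using sigma_cell[OF l(1) st] by blast
    have "mset (translate j (res_seq e \<kappa> l u)) = \<beta>" if "u \<in> std_tableaux l" for u
      using mset_translate[OF residue_tuple[OF l(1)]] \<open>j < p\<close> res_seq_mset[OF that] by (simp add: \<beta>_def)
    then have "(\<sigma> ^^ j) (c l s t) \<in> block scale e n \<epsilon> \<beta>"
      unfolding block_def h using st translate_tuple[OF residue_tuple[OF l(1)]] by (intro span_base) blast
    then show ?thesis unfolding block_orb_def using \<beta> by (intro span_base) blast
  qed
  then have "mu p \<sigma> (c l s t) \<in> block_orb scale e \<eta> n \<epsilon> \<alpha>"
    unfolding mu_def block_orb_def by (intro span_sum) simp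
  then show ?thesis by (simp add: fixed_block_orb_def mu_fixed)
qed

lemma span_mult_right:
  assumes "x \<in> span B"
  shows "x * y \<in> span ((\<lambda>b. b * y) ` B)"
proof -
  have "subspace {x. x * y \<in> span ((\<lambda>b. b * y) ` B)}"
    unfolding subspace_def
    by (auto simp: distrib_right scale_mult_left span_zero intro: span_add span_scale)
  moreover have "B \<subseteq> {x. x * y \<in> span ((\<lambda>b. b * y) ` B)}" by (auto intro: span_base)
  ultimately show ?thesis using assms span_minimal by blast
qed

text \<open>Right multiplication by \<open>low_idem\<close> maps the fixed subalgebra onto a space that contains the
  linearly independent elements \<open>c\<^sub>s\<^sub>t\<close> for which the residue sequence of \<open>t\<close> starts below \<open>\<eta>\<close>.\<close>

lemma fixed_block_dimension_bound:
  fixes \<alpha> :: "int multiset"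
  assumes B: "finite B" "span B = fixed_block_orb scale e \<eta> n \<epsilon> \<sigma> \<alpha>"
  defines "P \<equiv> multipartitions_orb e \<eta> \<kappa> r n \<alpha>"
  shows "(\<Sum>l\<in>P. card (std_tableaux l) * card {t \<in> std_tableaux l. first_residue t < int \<eta>}) \<le> card B"
proof -
  define I where "I = (SIGMA l:P. std_tableaux l \<times> {t \<in> std_tableaux l. first_residue t < int \<eta>})"
  define C where "C = (\<lambda>(l, s, t). c l s t) ` I"
  have P_mp: "l \<in> multipartitions r n" if "l \<in> P" for l using multipartitions_orbD(1) that P_def by blast
  have finP: "finite P" using P_mp fin_mp by (meson finite_subset subsetI)
  have "inj_on (\<lambda>(l, s, t). c l s t) I"
    by (rule inj_onI) (use cellular_datum_eqD[OF cell] P_mp in \<open>force simp: I_def\<close>)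
  then have "card C = card I" unfolding C_def by (rule card_image)
  also have "\<dots> = (\<Sum>l\<in>P. card (std_tableaux l) * card {t \<in> std_tableaux l. first_residue t < int \<eta>})"
    unfolding I_def using finP fin_std P_mp by (simp add: card_SigmaI card_cartesian_product)
  finally have card_C: "card C = \<dots>" .
  have "C \<subseteq> cellular_basis (multipartitions r n) std_tableaux c"
    unfolding C_def I_def cellular_basis_def using P_mp by auto
  then have indep: "independent C"
    using cell independent_mono by (auto simp: cellular_datum_def)
  have "C \<subseteq> span ((\<lambda>b. b * low_idem) ` B)"
  proof
    fix x assume "x \<in> C"
    then obtain l s t where x: "x = c l s t" "l \<in> P" "s \<in> std_tableaux l" "t \<in> std_tableaux l"
      "first_residue t < int \<eta>" by (auto simp: C_def I_def)
    have "mu p \<sigma> (c l s t) \<in> span B" using mu_in_fixed_block x P_def B(2) by simp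
    from span_mult_right[OF this, of low_idem] show "x \<in> span ((\<lambda>b. b * low_idem) ` B)"
      using mu_low_idem[OF P_mp] x by simp
  qed
  then have "card C \<le> card ((\<lambda>b. b * low_idem) ` B)"
    using independent_span_bound[OF _ indep] B(1) by blast
  also have "\<dots> \<le> card B" using B(1) by (rule card_image_le)
  finally show ?thesis using card_C by simp
qed

lemma orb_in_mp_orb:
  assumes "l \<in> multipartitions_orb e \<eta> \<kappa> r n \<alpha>" "\<nu> \<in> orb rot l"
  shows "\<nu> \<in> multipartitions_orb e \<eta> \<kappa> r n \<alpha>"
proof -
  note l = multipartitions_orbD[OF assms(1)]
  have "(rot ^^ j) l \<in> multipartitions_orb e \<eta> \<kappa> r n \<alpha>" for j
  proof (induction j)
    case (Suc j)
    note IH = multipartitions_orbD[OF Suc]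
    obtain k where "content e \<kappa> ((rot ^^ j) l) = (content_shift e \<eta> ^^ k) \<alpha>" using IH(2) by (auto simp: orb_def)
    then have "content e \<kappa> (rot ((rot ^^ j) l)) = (content_shift e \<eta> ^^ Suc k) \<alpha>"
      using content_shift_shape[OF mp_length[OF IH(1)] d_pos d_le_r kappa] by simp
    then have "content e \<kappa> (rot ((rot ^^ j) l)) \<in> orb (content_shift e \<eta>) \<alpha>" unfolding orb_def by blast
    then show ?case using shift_multipartitions[OF IH(1)] by (simp add: multipartitions_orb_def)
  qed (use assms in simp)
  then show ?thesis using assms(2) by (auto simp: orb_def)
qed

lemma sum_over_orbits:
  fixes f :: "multipartition \<Rightarrow> nat" and \<alpha> :: "int multiset"
  defines "P \<equiv> multipartitions_orb e \<eta> \<kappa> r n \<alpha>"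
  shows "(\<Sum>\<omega>\<in>orbit_shapes e \<eta> \<kappa> d r n \<alpha>. \<Sum>\<nu>\<in>\<omega>. f \<nu>) = (\<Sum>l\<in>P. f l)"
proof -
  have P_mp: "l \<in> multipartitions r n" if "l \<in> P" for l using multipartitions_orbD(1) that P_def by blast
  have un: "\<Union>(orbit_shapes e \<eta> \<kappa> d r n \<alpha>) = P"
    unfolding orbit_shapes_def P_def using orb_in_mp_orb orb_refl by fastforce
  have disj: "\<omega> \<inter> \<omega>' = {}" if \<omega>: "\<omega> \<in> orbit_shapes e \<eta> \<kappa> d r n \<alpha>" "\<omega>' \<in> orbit_shapes e \<eta> \<kappa> d r n \<alpha>" "\<omega> \<noteq> \<omega>'" for \<omega> \<omega>'
  proof -
    obtain l l' where l: "l \<in> P" "\<omega> = orb rot l" "l' \<in> P" "\<omega>' = orb rot l'"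
      using \<omega>(1,2) unfolding P_def orbit_shapes_def by blast
    then show ?thesis using orb_eq[OF shape_period[OF P_mp] p_gt_0] \<omega>(3) by blast
  qed
  have "finite \<omega>" if "\<omega> \<in> orbit_shapes e \<eta> \<kappa> d r n \<alpha>" for \<omega>
    using that finite_orb_shape P_mp P_def by (auto simp: orbit_shapes_def)
  then have "sum f (\<Union>(orbit_shapes e \<eta> \<kappa> d r n \<alpha>)) = (\<Sum>\<omega>\<in>orbit_shapes e \<eta> \<kappa> d r n \<alpha>. \<Sum>\<nu>\<in>\<omega>. f \<nu>)"
    using disj by (subst sum.Union_disjoint) auto
  then show ?thesis by (simp add: un)
qed

text \<open>Chosen tableaux and tableaux with first residue below \<open>\<eta>\<close> are equally many, namely \<open>N =
  #[l] #\<T>(l) / p\<close>, and all shapes in the orbit have \<open>#\<T>(l) = (p / #[l]) N\<close> tableaux.\<close>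

lemma orbit_square_bound:
  assumes l: "l \<in> multipartitions r n"
    and phi: "\<And>\<nu> t. \<nu> \<in> orb rot l \<Longrightarrow> t \<in> std_tableaux \<nu> \<Longrightarrow> \<phi> (orb rot t) \<in> orb rot t"
  defines "N \<equiv> card_std_tableaux0 r d \<phi> (orb rot l)"
  shows "(p div card (orb rot l)) * N\<^sup>2 \<le>
    (\<Sum>\<nu>\<in>orb rot l. card (std_tableaux \<nu>) * card {t \<in> std_tableaux \<nu>. first_residue t < int \<eta>})"
proof -
  let ?o = "card (orb rot l)" and ?\<tau> = "card (std_tableaux l)"
  let ?M = "\<Sum>\<nu>\<in>orb rot l. card {t \<in> std_tableaux \<nu>. first_residue t < int \<eta>}"
  have N: "p * N = ?o * ?\<tau>" unfolding N_def by (rule card_chosen_tableaux[OF l fin_std phi])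
  have "p * ?M = p * N" unfolding N by (rule card_low_tableaux[OF l fin_std])
  then have M: "?M = N" using p_gt_0 by simp
  have "(\<Sum>\<nu>\<in>orb rot l. card (std_tableaux \<nu>) * card {t \<in> std_tableaux \<nu>. first_residue t < int \<eta>}) = ?\<tau> * ?M"
    unfolding sum_distrib_left by (intro sum.cong refl) (simp add: card_std_rot[OF l _ fin_std])
  then have rhs: "(\<Sum>\<nu>\<in>orb rot l. card (std_tableaux \<nu>) * card {t \<in> std_tableaux \<nu>. first_residue t < int \<eta>}) = ?\<tau> * N"
    by (simp only: M)
  have "?o > 0" using finite_orb_shape[OF l] orb_refl[of l] by (auto simp: card_gt_0_iff)
  have "?o * ((p div ?o) * N) = ?o * (p div ?o) * N" by simp
  also have "\<dots> \<le> p * N" by (intro mult_le_mono1) (simp add: times_div_less_eq_dividend)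
  also have "\<dots> = ?o * ?\<tau>" by (rule N)
  finally have "(p div ?o) * N \<le> ?\<tau>" using \<open>?o > 0\<close> by simp
  then have "(p div ?o) * N * N \<le> ?\<tau> * N" by (rule mult_le_mono1)
  then show ?thesis unfolding rhs by (simp add: power2_eq_square mult.assoc)
qed

lemma chosen_tableaux_exist:
  assumes l: "l \<in> multipartitions r n"
    and phi: "\<And>\<nu> t. \<nu> \<in> orb rot l \<Longrightarrow> t \<in> std_tableaux \<nu> \<Longrightarrow> \<phi> (orb rot t) \<in> orb rot t"
  shows "0 < card_std_tableaux0 r d \<phi> (orb rot l)"
proof -
  have "0 < card (orb rot l)" using finite_orb_shape[OF l] orb_refl[of l] by (auto simp: card_gt_0_iff)
  moreover have "0 < card (std_tableaux l)" using std_tableau_exists[OF l] fin_std[OF l] by (simp add: card_gt_0_iff)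
  moreover have "p * card_std_tableaux0 r d \<phi> (orb rot l) = card (orb rot l) * card (std_tableaux l)"
    by (rule card_chosen_tableaux[OF l fin_std phi])
  ultimately have "0 < p * card_std_tableaux0 r d \<phi> (orb rot l)" by (simp only: nat_0_less_mult_iff)
  then show ?thesis by simp
qed

lemma card_orb_shape_le:
  assumes "l \<in> multipartitions r n" "(rot ^^ g) l = l" "0 < g"
  shows "card (orb rot l) \<le> g"
  unfolding orb_eq_image[OF assms(2,3)] using card_image_le[of "{..<g}"] by simp

end

theorem proposition5p31:
  fixes d \<eta> p n e r :: nat
    and \<kappa> :: "nat \<Rightarrow> int"
    and q \<zeta> :: "'f::field"
    and scale :: "'f \<Rightarrow> 'h::ring_1 \<Rightarrow> 'h"
    and S :: 'h and T :: "nat \<Rightarrow> 'h"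
    and \<sigma> star :: "'h \<Rightarrow> 'h"
    and \<epsilon> :: "int list \<Rightarrow> 'h" and \<psi> y :: "nat \<Rightarrow> 'h"
    and le :: "multipartition rel"
    and c :: "multipartition \<Rightarrow> tableau \<Rightarrow> tableau \<Rightarrow> 'h"
    and \<alpha> :: "int multiset"
    and \<phi> :: "tableau set \<Rightarrow> tableau"
  assumes "d \<ge> 1" "\<eta> \<ge> 1" "p \<ge> 1" "n \<ge> 1" "e = \<eta> * p" "e \<ge> 2" "r = d * p"
    and kappa: "\<forall>k<r. \<kappa> k \<in> {0..<int e} \<and> \<kappa> ((k + d) mod r) = (\<kappa> k + int \<eta>) mod int e"
    and q: "q \<noteq> 0" "q \<noteq> 1" "mult_order q e"
    and hecke: "ariki_koike scale q \<kappa> r n S T"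
    and zeta: "mult_order \<zeta> p"
    and sigma: "automorphism_on scale UNIV \<sigma>" "fun_order \<sigma> p"
      "\<sigma> S = scale \<zeta> S" "\<forall>a\<in>{1..<n}. \<sigma> (T a) = T a"
    and KL: "KL_generators scale e \<eta> n \<sigma> \<epsilon> \<psi> y"
    and star: "anti_automorphism_on scale UNIV star"
      "\<forall>i\<in>residue_tuples e n. star (\<epsilon> i) = \<epsilon> i"
      "\<forall>a\<in>{1..<n}. star (\<psi> a) = \<psi> a" "\<forall>a\<in>{1..n}. star (y a) = y a"
    and cell: "cellular_datum scale UNIV (multipartitions r n) le std_tableaux c"
      "\<forall>l\<in>multipartitions r n. \<forall>s\<in>std_tableaux l. \<forall>t\<in>std_tableaux l. star (c l s t) = c l t s"
      "\<forall>l\<in>multipartitions r n. \<forall>s\<in>std_tableaux l. \<forall>t\<in>std_tableaux l.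
         \<exists>h. c l s t = \<epsilon> (res_seq e \<kappa> l s) * h * \<epsilon> (res_seq e \<kappa> l t)"
    and alpha: "\<alpha> \<in> content e \<kappa> ` multipartitions r n"
    and phi: "\<forall>l\<in>multipartitions_orb e \<eta> \<kappa> r n \<alpha>. \<forall>t\<in>std_tableaux l.
         \<phi> (orb (shift r d) t) \<in> orb (shift r d) t"
    and "card (orb (content_shift e \<eta>) \<alpha>) < p" "odd p"
  shows "\<not> (\<exists>(\<Lambda> :: 'l set) le' (\<T> :: 'l \<Rightarrow> 'i set) c'.
      adapted_cellular_datum scale (fixed_block_orb scale e \<eta> n \<epsilon> \<sigma> \<alpha>) star p
        (orbit_shapes e \<eta> \<kappa> d r n \<alpha>) (card_std_tableaux0 r d \<phi>) \<Lambda> le' \<T> c' \<and>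
      {mu p \<sigma> (c l s t) | l s t. l \<in> multipartitions_orb e \<eta> \<kappa> r n \<alpha> \<and>
         s \<in> std_tableaux l \<and> t \<in> std_tableaux0 r d \<phi> l} = cellular_basis \<Lambda> \<T> c')"
proof
  let ?A = "fixed_block_orb scale e \<eta> n \<epsilon> \<sigma> \<alpha>"
  let ?Orbs = "orbit_shapes e \<eta> \<kappa> d r n \<alpha>"
  let ?N = "card_std_tableaux0 r d \<phi>"
  let ?P = "multipartitions_orb e \<eta> \<kappa> r n \<alpha>"
  let ?D = "\<lambda>\<omega>. p div card \<omega>"
  assume "\<exists>(\<Lambda> :: 'l set) le' (\<T> :: 'l \<Rightarrow> 'i set) c'.
      adapted_cellular_datum scale ?A star p ?Orbs ?N \<Lambda> le' \<T> c' \<and>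
      {mu p \<sigma> (c l s t) | l s t. l \<in> ?P \<and> s \<in> std_tableaux l \<and> t \<in> std_tableaux0 r d \<phi> l} =
        cellular_basis \<Lambda> \<T> c'"
  then obtain \<Lambda> :: "'l set" and le' and \<T> :: "'l \<Rightarrow> 'i set" and c' where
    adapted: "adapted_cellular_datum scale ?A star p ?Orbs ?N \<Lambda> le' \<T> c'" and
    basis: "{mu p \<sigma> (c l s t) | l s t. l \<in> ?P \<and> s \<in> std_tableaux l \<and> t \<in> std_tableaux0 r d \<phi> l} =
        cellular_basis \<Lambda> \<T> c'"
    by blast
  have alg: "assoc_algebra scale" using hecke by (simp add: ariki_koike_def)
  interpret assoc_algebra scale by (rule alg)
  interpret shifted_cellular_algebra d \<eta> p n e r \<kappa> scale \<sigma> star \<epsilon> le c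
    by unfold_locales (use assms in \<open>simp_all add: fun_order_def KL_generators_def\<close>)
  have cd: "cellular_datum scale ?A \<Lambda> le' \<T> c'"
    and star': "\<forall>l\<in>\<Lambda>. \<forall>s\<in>\<T> l. \<forall>t\<in>\<T> l. star (c' l s t) = c' l t s"
    using adapted by (auto simp: adapted_cellular_datum_def)
  obtain L where L: "\<And>\<omega> j. \<omega> \<in> ?Orbs \<Longrightarrow> j \<in> {1..?D \<omega>} \<Longrightarrow> card (\<T> (L \<omega> j)) = ?N \<omega>"
    and cover: "{L \<omega> j | \<omega> j. \<omega> \<in> ?Orbs \<and> j \<in> {1..?D \<omega>}} = \<Lambda>"
    using adapted unfolding adapted_cellular_datum_def by blast
  have P_mp: "l \<in> multipartitions r n" if "l \<in> ?P" for l using multipartitions_orbD(1)[OF that] .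
  have finP: "finite ?P" using P_mp fin_mp by (meson finite_subset subsetI)
  have finO: "finite ?Orbs" using finP by (simp add: orbit_shapes_def)
  have phi': "\<phi> (orb rot t) \<in> orb rot t" if "l \<in> ?P" "\<nu> \<in> orb rot l" "t \<in> std_tableaux \<nu>" for l \<nu> t
    using phi orb_in_mp_orb[OF that(1,2)] that(3) by blast

  \<comment> \<open>Upper bound for the number of basis elements that are fixed by the anti-automorphism.\<close>
  have "(\<Sum>l\<in>\<Lambda>. card (\<T> l)) = card {x \<in> cellular_basis \<Lambda> \<T> c'. star x = x}"
    by (rule card_star_fixed_cellular_basis[OF cd star', symmetric])
  also have "\<dots> \<le> card ((\<lambda>(l, t). mu p \<sigma> (c l t t)) ` (SIGMA l:?P. std_tableaux0 r d \<phi> l))"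
  proof (rule card_mono)
    show "finite ((\<lambda>(l, t). mu p \<sigma> (c l t t)) ` (SIGMA l:?P. std_tableaux0 r d \<phi> l))"
      using finP fin_std[OF P_mp] by (auto simp: std_tableaux0_def)
    show "{x \<in> cellular_basis \<Lambda> \<T> c'. star x = x} \<subseteq>
        (\<lambda>(l, t). mu p \<sigma> (c l t t)) ` (SIGMA l:?P. std_tableaux0 r d \<phi> l)"
    proof
      fix x assume "x \<in> {x \<in> cellular_basis \<Lambda> \<T> c'. star x = x}"
      then obtain l s t where x: "x = mu p \<sigma> (c l s t)" "l \<in> ?P" "s \<in> std_tableaux l"
        "t \<in> std_tableaux0 r d \<phi> l" and "star x = x"
        unfolding basis[symmetric] by blast
      then have "s = t"
        using star_fixed_mu[OF P_mp _ _ \<open>odd p\<close>] by (simp add: std_tableaux0_def)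
      then show "x \<in> (\<lambda>(l, t). mu p \<sigma> (c l t t)) ` (SIGMA l:?P. std_tableaux0 r d \<phi> l)"
        using x by force
    qed
  qed
  also have "\<dots> \<le> card (SIGMA l:?P. std_tableaux0 r d \<phi> l)"
    using finP fin_std[OF P_mp] by (intro card_image_le) (auto simp: std_tableaux0_def)
  also have "\<dots> = (\<Sum>l\<in>?P. card (std_tableaux0 r d \<phi> l))"
    using finP fin_std[OF P_mp] by (intro card_SigmaI) (auto simp: std_tableaux0_def)
  also have "\<dots> = (\<Sum>\<omega>\<in>?Orbs. ?N \<omega>)"
    unfolding card_std_tableaux0_def by (rule sum_over_orbits[symmetric])
  finally have fixed_bound: "(\<Sum>l\<in>\<Lambda>. card (\<T> l)) \<le> (\<Sum>\<omega>\<in>?Orbs. ?N \<omega>)" .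

  \<comment> \<open>The dimension of the fixed subalgebra forbids coincidences among the cells \<open>L \<omega> j\<close>.\<close>
  have "(\<Sum>\<omega>\<in>?Orbs. ?D \<omega> * (?N \<omega>)\<^sup>2) \<le> (\<Sum>\<omega>\<in>?Orbs. \<Sum>\<nu>\<in>\<omega>.
      card (std_tableaux \<nu>) * card {t \<in> std_tableaux \<nu>. first_residue t < int \<eta>})"
  proof (rule sum_mono)
    fix \<omega> assume "\<omega> \<in> ?Orbs"
    then obtain l where l: "l \<in> ?P" "\<omega> = orb rot l" by (auto simp: orbit_shapes_def)
    show "?D \<omega> * (?N \<omega>)\<^sup>2 \<le> (\<Sum>\<nu>\<in>\<omega>. card (std_tableaux \<nu>) * card {t \<in> std_tableaux \<nu>. first_residue t < int \<eta>})"
      unfolding l(2) by (rule orbit_square_bound[OF P_mp[OF l(1)] phi'[OF l(1)]])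
  qed
  also have "\<dots> = (\<Sum>l\<in>?P. card (std_tableaux l) * card {t \<in> std_tableaux l. first_residue t < int \<eta>})"
    by (rule sum_over_orbits)
  also have "\<dots> \<le> card (cellular_basis \<Lambda> \<T> c')"
    by (rule fixed_block_dimension_bound[OF card_cellular_basis(1)[OF cd]])
       (use cd in \<open>simp add: cellular_datum_def\<close>)
  also have "\<dots> = (\<Sum>l\<in>\<Lambda>. (card (\<T> l))\<^sup>2)" by (rule card_cellular_basis(2)[OF cd])
  finally have squares: "(\<Sum>\<omega>\<in>?Orbs. ?D \<omega> * (?N \<omega>)\<^sup>2) \<le> (\<Sum>l\<in>\<Lambda>. (card (\<T> l))\<^sup>2)" .
  have total: "(\<Sum>l\<in>\<Lambda>. card (\<T> l)) = (\<Sum>\<omega>\<in>?Orbs. ?D \<omega> * ?N \<omega>)"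
    by (rule square_sum_forces_injective[where w = "\<lambda>l. card (\<T> l)" and N = ?N and D = ?D, OF finO cover _ squares])
       (rule L)

  \<comment> \<open>An orbit of shapes with at most \<open>p / 2\<close> elements makes the two counts incompatible.\<close>
  obtain l0 where l0: "l0 \<in> multipartitions r n" "\<alpha> = content e \<kappa> l0" using alpha by blast
  have "card (orb (content_shift e \<eta>) (content e \<kappa> l0)) < p" using assms l0(2) by simp
  then obtain l g where l: "l \<in> multipartitions r n" "content e \<kappa> l = \<alpha>"
    and g: "0 < g" "g < p" "g dvd p" "(rot ^^ g) l = l"
    using stuttering_shape_exists[OF d_pos eta_pos p_pos e_def r_def kappa l0(1)] l0(2) by metis
  have lP: "l \<in> ?P"
    using l orb_refl[of \<alpha> "content_shift e \<eta>"] by (simp add: multipartitions_orb_def)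
  then have \<omega>: "orb rot l \<in> ?Orbs" by (simp add: orbit_shapes_def)
  have D1: "1 \<le> ?D \<omega>" if \<omega>: "\<omega> \<in> ?Orbs" for \<omega>
  proof -
    obtain l where l: "l \<in> ?P" "\<omega> = orb rot l" using \<omega> by (auto simp: orbit_shapes_def)
    have "card \<omega> \<le> p" using card_orb_shape_le[OF P_mp[OF l(1)] shape_period p_gt_0] P_mp l by simp
    moreover have "0 < card \<omega>"
      using finite_orb_shape[OF P_mp[OF l(1)]] orb_refl[of l] l(2) by (auto simp: card_gt_0_iff)
    ultimately show ?thesis by (simp add: Suc_le_eq div_greater_zero_iff)
  qed
  have "2 \<le> ?D (orb rot l)"
  proof -
    obtain k where k: "p = g * k" using g(3) by blast
    have "2 \<le> k" using k g(1,2) by (cases k; cases "k - 1") auto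
    moreover have "k \<le> ?D (orb rot l)"
    proof -
      have o: "0 < card (orb rot l)"
        using finite_orb_shape[OF l(1)] orb_refl[of l] by (auto simp: card_gt_0_iff)
      have "k * card (orb rot l) \<le> p"
        unfolding k using card_orb_shape_le[OF l(1) g(4,1)] by (simp add: mult.commute)
      then show ?thesis using o by (simp add: less_eq_div_iff_mult_less_eq)
    qed
    ultimately show ?thesis by linarith
  qed
  then have "?N (orb rot l) < ?D (orb rot l) * ?N (orb rot l)"
    using chosen_tableaux_exist[OF l(1) phi'[OF lP]] by simp
  moreover have "?N \<omega> \<le> ?D \<omega> * ?N \<omega>" if "\<omega> \<in> ?Orbs" for \<omega>
    using D1[OF that] by simp
  ultimately have "(\<Sum>\<omega>\<in>?Orbs. ?N \<omega>) < (\<Sum>\<omega>\<in>?Orbs. ?D \<omega> * ?N \<omega>)"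
    using \<omega> finO by (intro sum_strict_mono_ex1) auto
  then show False using fixed_bound total by linarith
qed

end
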